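(* Let $\mathbb{K}$ be a field, $\ell\ge 4$, $V=\mathbb{K}^\ell$, and let $\mathcal{A}'$ be an essential, free, central hyperplane arrangement in $V$. Let $X\subset V$ be a linear subspace with $X\notin L(\mathcal{A}')$ which is generic with respect to $\mathcal{A}'$, and with $\dim X>2$. Let $\mathcal{A}'\cap X:=\{H\cap X\mid H\in\mathcal{A}'\}$, viewed as an arrangement in $X$. Then: (i) the restriction map $\Omega^1(\mathcal{A}')\to\Omega^1(\mathcal{A}'\cap X)$ is surjective; (ii) the minimal number of generators of $\Omega^1(\mathcal{A}')$ equals the minimal number of generators of $\Omega^1(\mathcal{A}'\cap X)$; (iii) the arrangement $\mathcal{A}'\cap X$ is not free.
   Context: $S=\mathbb{K}[x_1,\dots,x_\ell]$ is the coordinate ring of $V$, graded by $\deg x_i=1$. A central arrangement $\mathcal{A}$ is a finite set of linear hyperplanes in $V$ (assumed simple: distinct hyperplanes); for $H\in\mathcal{A}$ fix $\alpha_H\in V^*$ with $\ker\alpha_H=H$ and put $Q(\mathcal{A})=\prod_{H\in\mathcal{A}}\alpha_H$. Let $\Omega^1_V=\bigoplus_i S\,dx_i$, $\Omega^2_V=\Lambda^2\Omega^1_V$. The module of logarithmic 1-forms is $\Omega^1(\mathcal{A})=\{\omega\in\frac{1}{Q(\mathcal{A})}\Omega^1_V\mid \omega\wedge d\alpha_H\in\frac{\alpha_H}{Q(\mathcal{A})}\Omega^2_V\ \forall H\in\mathcal{A}\}$, graded with $\deg dx_i=0$. The module of logarithmic derivations is $D(\mathcal{A})=\{\theta\in\bigoplus_i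 S\partial_{x_i}\mid \theta(\alpha_H)\in S\alpha_H\ \forall H\in\mathcal{A}\}$; $\mathcal{A}$ is free if $D(\mathcal{A})$ (equivalently its dual $\Omega^1(\mathcal{A})$) is a free $S$-module. The same definitions apply to arrangements in any subspace $X$ using its coordinate ring. $L(\mathcal{A})$ is the set of all intersections of subsets of $\mathcal{A}$; $\mathcal{A}$ is essential if $\bigcap_{H\in\mathcal{A}}H=\{0\}$. For an essential arrangement $\mathcal{A}$, a subspace $X\notin L(\mathcal{A})$ is generic with respect to $\mathcal{A}$ if $\operatorname{codim}_V(X\cap Y)=\operatorname{codim}_V X+\operatorname{codim}_V Y$ for all $Y\in L(\mathcal{A})$ with $\operatorname{codim}_V Y\le \ell-\operatorname{codim}_V X$. The restriction map $\Omega^1(\mathcal{A}')\to\Omega^1(\mathcal{A}'\cap X)$ is given by pulling back differential forms along the inclusion $X\subset V$. *)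

theory Defs
  imports
    "HOL-Analysis.Analysis"
    "HOL-Library.Poly_Mapping"
    "HOL-Library.Extended_Nat"
    "HOL-Computational_Algebra.Polynomial_Factorial"
begin

section \<open>Coordinate rings and rational functions\<close>

text \<open>
  The space \<open>V\<close> is \<open>'k ^ 'n\<close>, and its coordinate ring \<open>S\<close> consists of formal polynomials in
  variables indexed by \<open>'n\<close> (a map from exponent vectors to coefficients), not of polynomial
  functions: the two differ over finite fields. A linear order on \<open>'n\<close> is what the library needs
  in order to recognise \<open>S\<close> as an integral domain; it plays no other role, and every finite index
  set admits one.
\<close>

type_synonym ('k, 'n) coord_ring = "('n \<Rightarrow>\<^sub>0 nat) \<Rightarrow>\<^sub>0 'k"

type_synonym ('k, 'n) rat_fun = "('k, 'n) coord_ring fract"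

definition coord_var :: "'n \<Rightarrow> ('k::field, 'n) coord_ring" where
  "coord_var i = Poly_Mapping.single (Poly_Mapping.single i 1) 1"

definition coord_const :: "'k \<Rightarrow> ('k::field, 'n) coord_ring" where
  "coord_const c = Poly_Mapping.single 0 c"

text \<open>Where the subtraction of exponents truncates, the coefficient is zero.\<close>

definition partial_deriv :: "'n \<Rightarrow> ('k::field, 'n) coord_ring \<Rightarrow> ('k, 'n) coord_ring" where
  "partial_deriv i p =
     (\<Sum>m\<in>Poly_Mapping.keys p. Poly_Mapping.single (m - Poly_Mapping.single i 1)
        (of_nat (Poly_Mapping.lookup m i) * Poly_Mapping.lookup p m))"

text \<open>A covector is given by its coefficients, and is an element of \<open>S\<close> via \<open>linear_form\<close>.\<close>

definition linear_form :: "'k::field ^ 'n::finite \<Rightarrow> ('k, 'n) coord_ring" where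
  "linear_form a = (\<Sum>i\<in>UNIV. coord_const (a $ i) * coord_var i)"

definition covector_kernel :: "'k::field ^ 'n::finite \<Rightarrow> ('k ^ 'n) set" where
  "covector_kernel a = {v. (\<Sum>i\<in>UNIV. a $ i * v $ i) = 0}"


section \<open>Modules\<close>

definition free_submodule :: "('a::comm_ring_1 \<Rightarrow> 'b::ab_group_add \<Rightarrow> 'b) \<Rightarrow> 'b set \<Rightarrow> bool" where
  "free_submodule smul M \<longleftrightarrow>
     (\<exists>B. \<not> module.dependent smul B \<and> module.span smul B = M)"

text \<open>The value is \<open>\<infinity>\<close> for a module that is not finitely generated.\<close>

definition min_generators :: "('a::comm_ring_1 \<Rightarrow> 'b::ab_group_add \<Rightarrow> 'b) \<Rightarrow> 'b set \<Rightarrow> enat" where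
  "min_generators smul M = (INF B\<in>{B. finite B \<and> module.span smul B = M}. enat (card B))"

text \<open>
  The two ambient \<open>S\<close>-modules: vectors of polynomials (scaled by \<open>(*s)\<close>) and vectors of rational
  functions.
\<close>

definition rat_scale ::
  "('k::field, 'n::{finite,linorder}) coord_ring \<Rightarrow>
     ('k, 'n) rat_fun ^ 'n::{finite,linorder} \<Rightarrow> ('k, 'n) rat_fun ^ 'n::{finite,linorder}"
  where "rat_scale p \<omega> = to_fract p *s \<omega>"

lemma module_poly_vec: "module ((*s) :: 'a::comm_ring_1 \<Rightarrow> 'a ^ 'n::finite \<Rightarrow> 'a ^ 'n)"
  by (standard; simp add: vec_eq_iff algebra_simps)

lemma module_rat_scale:
  "module (rat_scale :: ('k::field, 'n::{finite,linorder}) coord_ring \<Rightarrow> _)"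
  by (standard; simp add: rat_scale_def vec_eq_iff algebra_simps)


section \<open>Arrangements\<close>

definition hyperplane :: "('k::field ^ 'n::finite) set \<Rightarrow> bool" where
  "hyperplane H \<longleftrightarrow> vec.subspace H \<and> vec.dim H + 1 = CARD('n)"

definition arrangement :: "('k::field ^ 'n::finite) set set \<Rightarrow> bool" where
  "arrangement A \<longleftrightarrow> finite A \<and> (\<forall>H\<in>A. hyperplane H)"

definition essential :: "('k::field ^ 'n::finite) set set \<Rightarrow> bool" where
  "essential A \<longleftrightarrow> \<Inter>A = {0}"

text \<open>The empty intersection is the whole space.\<close>

definition intersection_lattice :: "('k::field ^ 'n::finite) set set \<Rightarrow> ('k ^ 'n) set set" where
  "intersection_lattice A = {\<Inter>B | B. B \<subseteq> A}"

definition codim :: "('k::field ^ 'n::finite) set \<Rightarrow> nat" where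
  "codim X = CARD('n) - vec.dim X"

definition generic_wrt :: "('k::field ^ 'n::finite) set set \<Rightarrow> ('k ^ 'n) set \<Rightarrow> bool" where
  "generic_wrt A X \<longleftrightarrow>
     X \<notin> intersection_lattice A \<and>
     (\<forall>Y\<in>intersection_lattice A.
        codim Y \<le> CARD('n) - codim X \<longrightarrow> codim (X \<inter> Y) = codim X + codim Y)"

text \<open>
  The fixed choice of \<open>\<alpha>\<^sub>H\<close>. Two choices differ by a nonzero scalar, on which none of the modules
  below depends.
\<close>

definition defining_covector :: "('k::field ^ 'n::finite) set \<Rightarrow> 'k ^ 'n" where
  "defining_covector H = (SOME a. covector_kernel a = H)"

abbreviation defining_form :: "('k::field ^ 'n::finite) set \<Rightarrow> ('k, 'n) coord_ring" where
  "defining_form H \<equiv> linear_form (defining_covector H)"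

definition defining_poly :: "('k::field ^ 'n::finite) set set \<Rightarrow> ('k, 'n) coord_ring" where
  "defining_poly A = (\<Prod>H\<in>A. defining_form H)"


section \<open>Logarithmic derivations\<close>

text \<open>The vector \<open>\<theta>\<close> stands for the derivation \<open>\<Sum>i. \<theta> $ i \<partial>\<^sub>i\<close>.\<close>

definition apply_derivation ::
  "('k::field, 'n) coord_ring ^ 'n::finite \<Rightarrow> ('k, 'n) coord_ring \<Rightarrow> ('k, 'n) coord_ring" where
  "apply_derivation \<theta> f = (\<Sum>i\<in>UNIV. \<theta> $ i * partial_deriv i f)"

definition log_derivations ::
  "('k::field ^ 'n::finite) set set \<Rightarrow> (('k, 'n) coord_ring ^ 'n) set" where
  "log_derivations A = {\<theta>. \<forall>H\<in>A. defining_form H dvd apply_derivation \<theta> (defining_form H)}"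

definition free_arrangement :: "('k::field ^ 'n::finite) set set \<Rightarrow> bool" where
  "free_arrangement A \<longleftrightarrow> free_submodule (*s) (log_derivations A)"


section \<open>Logarithmic 1-forms\<close>

text \<open>
  The vector \<open>\<omega>\<close> stands for the rational 1-form \<open>\<Sum>i. \<omega> $ i dx\<^sub>i\<close>. A rational 2-form is the
  alternating matrix \<open>w\<close> for which it equals \<open>\<Sum>i<j. w $ i $ j dx\<^sub>i \<and> dx\<^sub>j\<close>.
\<close>

definition differential ::
  "('k::field, 'n::{finite,linorder}) coord_ring \<Rightarrow> ('k, 'n) rat_fun ^ 'n::{finite,linorder}" where
  "differential f = (\<chi> i. to_fract (partial_deriv i f))"

definition wedge :: "'a::comm_ring_1 ^ 'n \<Rightarrow> 'a ^ 'n \<Rightarrow> 'a ^ 'n ^ 'n" where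
  "wedge \<omega> \<eta> = (\<chi> i j. \<omega> $ i * \<eta> $ j - \<omega> $ j * \<eta> $ i)"

definition regular_1_forms :: "(('k::field, 'n::{finite,linorder}) rat_fun ^ 'n::{finite,linorder}) set" where
  "regular_1_forms = {\<omega>. \<forall>i. \<omega> $ i \<in> range to_fract}"

definition regular_2_forms ::
  "(('k::field, 'n::{finite,linorder}) rat_fun ^ 'n::{finite,linorder} ^ 'n::{finite,linorder}) set" where
  "regular_2_forms =
     {w. (\<forall>i j. w $ i $ j \<in> range to_fract) \<and> (\<forall>i. w $ i $ i = 0) \<and>
         (\<forall>i j. w $ j $ i = - w $ i $ j)}"

definition log_1_forms ::
  "('k::field ^ 'n::{finite,linorder}) set set \<Rightarrow> (('k, 'n) rat_fun ^ 'n::{finite,linorder}) set" where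
  "log_1_forms A =
     {\<omega>. (\<exists>\<eta>\<in>regular_1_forms. \<omega> = (1 / to_fract (defining_poly A)) *s \<eta>) \<and>
         (\<forall>H\<in>A. \<exists>w\<in>regular_2_forms.
            wedge \<omega> (differential (defining_form H)) =
              (\<chi> i j. to_fract (defining_form H) / to_fract (defining_poly A) * w $ i $ j))}"


section \<open>Restriction to a subspace\<close>

text \<open>
  The coordinate ring of a subspace \<open>X\<close> of \<open>V\<close> is a polynomial ring once a basis of \<open>X\<close> is chosen.
  Such a choice is a matrix \<open>M\<close> whose columns form a basis of \<open>X\<close>: then \<open>t \<mapsto> M *v t\<close> identifies
  \<open>'k ^ 'm\<close> with \<open>X\<close>, and arrangements in \<open>X\<close> with arrangements in \<open>'k ^ 'm\<close>. The inclusion of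
  \<open>X\<close> in \<open>V\<close> becomes this parametrization, which pulls \<open>x\<^sub>j\<close> back to
  \<open>\<Sum>i. M $ j $ i t\<^sub>i\<close> and \<open>dx\<^sub>j\<close> to \<open>\<Sum>i. M $ j $ i dt\<^sub>i\<close>.
\<close>

definition linear_coordinates :: "'k::field ^ 'm::finite ^ 'n::finite \<Rightarrow> ('k ^ 'n) set \<Rightarrow> bool" where
  "linear_coordinates M X \<longleftrightarrow> inj ((*v) M) \<and> range ((*v) M) = X"

definition restrict_arrangement ::
  "('k::field ^ 'n::finite) set set \<Rightarrow> ('k ^ 'n) set \<Rightarrow> ('k ^ 'n) set set" where
  "restrict_arrangement A X = {H \<inter> X | H. H \<in> A}"

definition in_coordinates ::
  "'k::field ^ 'm::finite ^ 'n::finite \<Rightarrow> ('k ^ 'n) set set \<Rightarrow> ('k ^ 'm) set set" where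
  "in_coordinates M B = (\<lambda>H. (*v) M -` H) ` B"

definition pullback_poly ::
  "'k::field ^ 'm::finite ^ 'n::finite \<Rightarrow> ('k, 'n) coord_ring \<Rightarrow> ('k, 'm) coord_ring" where
  "pullback_poly M p =
     (\<Sum>e\<in>Poly_Mapping.keys p. coord_const (Poly_Mapping.lookup p e) *
        (\<Prod>j\<in>UNIV. linear_form (M $ j) ^ Poly_Mapping.lookup e j))"

text \<open>
  A rational function can be pulled back when it has a denominator whose pullback is a nonzero
  polynomial; the result does not depend on the fraction. The value is
  meaningless for other rational functions.
\<close>

definition pullback_rat_fun ::
  "'k::field ^ 'm::{finite,linorder} ^ 'n::{finite,linorder} \<Rightarrow> ('k, 'n) rat_fun \<Rightarrow> ('k, 'm) rat_fun"
  where
  "pullback_rat_fun M f =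
     (THE g. \<exists>p q. pullback_poly M q \<noteq> 0 \<and> f = to_fract p / to_fract q \<and>
                   g = to_fract (pullback_poly M p) / to_fract (pullback_poly M q))"

definition pullback_1_form ::
  "'k::field ^ 'm::{finite,linorder} ^ 'n::{finite,linorder} \<Rightarrow>
     ('k, 'n) rat_fun ^ 'n::{finite,linorder} \<Rightarrow> ('k, 'm) rat_fun ^ 'm::{finite,linorder}" where
  "pullback_1_form M \<omega> =
     (\<chi> i. \<Sum>j\<in>UNIV. to_fract (coord_const (M $ j $ i)) * pullback_rat_fun M (\<omega> $ j))"

end

theory Submission
  imports Defs
begin

text \<open>
  Write \<open>S\<close> and \<open>R\<close> for the coordinate rings of the ambient space and of \<open>X\<close>. Logarithmic forms
  are exactly the rational forms that pair integrally with the logarithmic derivations, so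
  freeness makes \<open>\<Omega>\<^sup>1(A)\<close> free on a dual basis, and tensoring it with \<open>R\<close> gives the module \<open>U\<close> of
  forms that pair integrally with the restricted derivations. A form in \<open>U\<close> that vanishes on
  vectors tangent to \<open>X\<close> is regular.

  Surjectivity of \<open>U \<rightarrow> \<Omega>\<^sup>1(A \<inter> X)\<close>: at a flat of codimension at most \<open>dim X\<close> genericity gives a
  projection of the ambient space onto \<open>X\<close> that preserves the hyperplanes through the flat, hence
  a local section. A form outside the image could therefore be multiplied by linear forms until
  it is still outside the image but every linear form multiplies it into the image; since
  \<open>dim X \<ge> 3\<close>, the Koszul relations among three coordinates exclude this.

  As \<open>A\<close> is essential, logarithmic derivations have no constant terms, so the elements of \<open>U\<close>
  that restrict to zero have coefficients without constant term in the dual basis. Hence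
  restriction preserves the minimal number of generators, which is the dimension of the ambient
  space, whereas freeness of \<open>A \<inter> X\<close> would allow only \<open>dim X\<close> generators.
\<close>

section \<open>Substitution of linear forms\<close>

text \<open>Restricting a form moves its rational coefficients to \<open>X\<close> and also forgets
  the differentials transverse to \<open>X\<close>. Splitting the map as
  \<open>restrict_coeffs\<close> followed by \<open>pull_vec\<close> isolates freeness: the first
  half is onto \<open>U\<close> because prescribed pairings with a basis of derivations can be
  lifted one by one. The second half is a question over the coordinate ring of \<open>X\<close>
  alone.

  In geometric terms, the cokernel of the second half is supported at the origin, and it vanishes
  because the kernel is a free module over a polynomial ring in at least three variables.
  Localization is replaced here by multiplication with products of linear forms, and the depth
  argument by an explicit computation with three variables.

  Generators are counted modulo the maximal ideal of the origin, by taking constant terms, so that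
  arbitrary generating sets can be treated without homogeneity.

  Covectors are carried as a family indexed by the ambient hyperplanes. Their restrictions describe
  the section directly, whereas covectors chosen afresh for its hyperplanes agree with them only up
  to scalars.\<close>

lemma partial_deriv_sum_superset:
  assumes "finite T" "Poly_Mapping.keys p \<subseteq> T"
  shows "partial_deriv i p =
     (\<Sum>m\<in>T. Poly_Mapping.single (m - Poly_Mapping.single i 1)
        (of_nat (Poly_Mapping.lookup m i) * Poly_Mapping.lookup p m))"
  unfolding partial_deriv_def using assms
  by (intro sum.mono_neutral_left) (auto simp: in_keys_iff)

lemma partial_deriv_zero [simp]: "partial_deriv i 0 = 0"
  by (simp add: partial_deriv_def)

lemma partial_deriv_add: "partial_deriv i (p + q) = partial_deriv i p + partial_deriv i q"
proof -
  let ?T = "Poly_Mapping.keys p \<union> Poly_Mapping.keys q"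
  have "Poly_Mapping.keys (p + q) \<subseteq> ?T" by (rule Poly_Mapping.keys_add)
  then show ?thesis
    by (subst (1 2 3) partial_deriv_sum_superset[of ?T])
      (auto simp: lookup_add single_add algebra_simps sum.distrib)
qed

lemma partial_deriv_sum: "partial_deriv i (sum f T) = (\<Sum>x\<in>T. partial_deriv i (f x))"
  by (induction T rule: infinite_finite_induct) (auto simp: partial_deriv_add)

lemma coord_const_mult_var:
  "coord_const c * coord_var j = Poly_Mapping.single (Poly_Mapping.single j 1) c"
  by (simp add: coord_const_def coord_var_def mult_single)

lemma partial_deriv_linear_form: "partial_deriv i (linear_form a) = coord_const (a $ i)"
proof -
  have "partial_deriv i (coord_const (a $ j) * coord_var j) = (if j = i then coord_const (a $ i) else 0)" for j
  proof (cases "a $ j = 0")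
    case False
    then show ?thesis
      unfolding coord_const_mult_var
      by (auto simp: partial_deriv_def lookup_single when_def coord_const_def)
  qed (auto simp: coord_const_def)
  then show ?thesis
    by (simp add: linear_form_def partial_deriv_sum)
qed

lemma coord_const_0 [simp]: "coord_const 0 = 0"
  by (simp add: coord_const_def)

lemma coord_const_1 [simp]: "coord_const 1 = 1"
  by (simp add: coord_const_def)

lemma coord_const_add: "coord_const (a + b) = coord_const a + coord_const b"
  by (simp add: coord_const_def single_add)

lemma coord_const_diff: "coord_const (a - b) = coord_const a - coord_const b"
  by (simp add: coord_const_def single_diff)

lemma coord_const_mult: "coord_const (a * b) = coord_const a * coord_const b"
  by (simp add: coord_const_def mult_single)

lemma coord_const_sum: "coord_const (sum f T) = (\<Sum>x\<in>T. coord_const (f x))"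
  by (induction T rule: infinite_finite_induct) (auto simp: coord_const_add)

lemma coord_const_eq_0_iff [simp]: "coord_const c = 0 \<longleftrightarrow> c = 0"
  by (metis coord_const_def coord_const_0 lookup_single_eq)

lemma lookup_coord_const_0 [simp]: "Poly_Mapping.lookup (coord_const c) 0 = c"
  by (simp add: coord_const_def)

lemma linear_form_axis:
  "linear_form (axis j 1 :: 'k::field ^ 'n::finite) = coord_var j"
proof -
  have "coord_const (axis j (1::'k) $ i) * coord_var i = (if i = j then coord_var j else 0)" for i :: 'n
    by (simp add: axis_def)
  then show ?thesis by (simp add: linear_form_def)
qed

lemma linear_form_add: "linear_form (a + b) = linear_form a + linear_form b"
  by (simp add: linear_form_def coord_const_add algebra_simps sum.distrib)

lemma linear_form_diff: "linear_form (a - b) = linear_form a - linear_form b"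
  by (simp add: linear_form_def coord_const_diff algebra_simps sum_subtractf)

lemma linear_form_smult: "linear_form (c *s a) = coord_const c * linear_form a"
  by (simp add: linear_form_def coord_const_mult sum_distrib_left mult.assoc)

lemma linear_form_zero [simp]: "linear_form 0 = 0"
  by (simp add: linear_form_def)

lemma linear_form_eq_0_iff [simp]:
  fixes a :: "'k::field ^ 'n::finite"
  shows "linear_form a = 0 \<longleftrightarrow> a = 0"
proof
  assume "linear_form a = 0"
  then have "(coord_const (a $ i) :: ('k, 'n) coord_ring) = 0" for i
    using partial_deriv_linear_form[of i a] by simp
  then show "a = 0" by (simp add: vec_eq_iff)
qed simp

section \<open>Substitution as a ring homomorphism\<close>

lemma pullback_poly_sum_superset:
  assumes "finite T" "Poly_Mapping.keys p \<subseteq> T"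
  shows "pullback_poly M p =
     (\<Sum>e\<in>T. coord_const (Poly_Mapping.lookup p e) *
        (\<Prod>j\<in>UNIV. linear_form (M $ j) ^ Poly_Mapping.lookup e j))"
  unfolding pullback_poly_def using assms
  by (intro sum.mono_neutral_left) (auto simp: in_keys_iff)

lemma pullback_poly_zero [simp]: "pullback_poly M 0 = 0"
  by (simp add: pullback_poly_def)

lemma pullback_poly_add: "pullback_poly M (p + q) = pullback_poly M p + pullback_poly M q"
proof -
  let ?T = "Poly_Mapping.keys p \<union> Poly_Mapping.keys q"
  have "Poly_Mapping.keys (p + q) \<subseteq> ?T" by (rule Poly_Mapping.keys_add)
  then show ?thesis
    by (subst (1 2 3) pullback_poly_sum_superset[of ?T])
      (auto simp: lookup_add coord_const_add algebra_simps sum.distrib)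
qed

lemma pullback_poly_single: "pullback_poly M (Poly_Mapping.single e c) =
    coord_const c * (\<Prod>j\<in>UNIV. linear_form (M $ j) ^ Poly_Mapping.lookup e j)"
  by (simp add: pullback_poly_def)

lemma poly_mapping_single_add_induct [case_names zero single_add]:
  assumes "P 0" and "\<And>p e c. P p \<Longrightarrow> P (Poly_Mapping.single e c + p)"
  shows "P (p :: 'e \<Rightarrow>\<^sub>0 'c::comm_monoid_add)"
proof (induction p rule: update_induct)
  case const
  then show ?case using assms(1) by simp
next
  case (update f e c)
  have "Poly_Mapping.update e c f = Poly_Mapping.single e c + f"
    using update by (intro poly_mapping_eqI)
      (auto simp: lookup_update lookup_add lookup_single when_def in_keys_iff)
  with assms(2)[OF update(3)] show ?case by simp
qed

lemma pullback_poly_mult: "pullback_poly M (p * q) = pullback_poly M p * pullback_poly M q"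
proof (induction p rule: poly_mapping_single_add_induct)
  case (single_add p e c)
  have "pullback_poly M (Poly_Mapping.single e c * q)
      = pullback_poly M (Poly_Mapping.single e c) * pullback_poly M q"
  proof (induction q rule: poly_mapping_single_add_induct)
    case (single_add q f d)
    then show ?case
      by (simp add: pullback_poly_add distrib_left mult_single pullback_poly_single lookup_add
          power_add prod.distrib coord_const_mult algebra_simps)
  qed simp
  with single_add show ?case
    by (simp add: pullback_poly_add distrib_right)
qed simp

lemma pullback_poly_const [simp]: "pullback_poly M (coord_const c) = coord_const c"
  unfolding coord_const_def[of c] by (subst pullback_poly_single) (simp add: coord_const_def)

lemma pullback_poly_one [simp]: "pullback_poly M 1 = 1"
  using pullback_poly_const[of M 1] by simp

lemma pullback_poly_uminus [simp]: "pullback_poly M (- p) = - pullback_poly M p"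
  by (metis add.right_inverse add_eq_0_iff pullback_poly_add pullback_poly_zero)

lemma pullback_poly_diff: "pullback_poly M (p - q) = pullback_poly M p - pullback_poly M q"
  by (metis pullback_poly_add pullback_poly_uminus diff_conv_add_uminus)

lemma pullback_poly_sum: "pullback_poly M (sum f T) = (\<Sum>x\<in>T. pullback_poly M (f x))"
  by (induction T rule: infinite_finite_induct) (auto simp: pullback_poly_add)

lemma pullback_poly_prod: "pullback_poly M (prod f T) = (\<Prod>x\<in>T. pullback_poly M (f x))"
  by (induction T rule: infinite_finite_induct) (auto simp: pullback_poly_mult)

lemma pullback_poly_var [simp]: "pullback_poly M (coord_var j) = linear_form (M $ j)"
proof -
  have "linear_form (M $ i) ^ Poly_Mapping.lookup (Poly_Mapping.single j 1) i
      = (if i = j then linear_form (M $ j) else 1)" for i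
    by (auto simp: lookup_single when_def)
  then show ?thesis
    unfolding coord_var_def by (subst pullback_poly_single) simp
qed

lemma pullback_poly_linear_form:
  "pullback_poly M (linear_form a) = linear_form (transpose M *v a)"
proof -
  have "pullback_poly M (linear_form a) = (\<Sum>j\<in>UNIV. \<Sum>i\<in>UNIV. coord_const (a $ j * M $ j $ i) * coord_var i)"
    unfolding linear_form_def[of a]
    by (simp add: pullback_poly_sum pullback_poly_mult linear_form_def coord_const_mult
        sum_distrib_left mult.assoc)
  also have "\<dots> = linear_form (transpose M *v a)"
    by (subst sum.swap)
      (simp add: linear_form_def matrix_vector_mult_def transpose_def coord_const_sum sum_distrib_right mult.commute sum_distrib_left)
  finally show ?thesis .
qed

text \<open>The induction suited to ring homomorphisms that fix the constants: an identity between
  two of them has to be checked on the variables only.\<close>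

lemma coord_ring_induct [case_names const var add mult]:
  assumes const: "\<And>c. P (coord_const c)" and var: "\<And>i. P (coord_var i)"
    and add: "\<And>p q. P p \<Longrightarrow> P q \<Longrightarrow> P (p + q)" and mult: "\<And>p q. P p \<Longrightarrow> P q \<Longrightarrow> P (p * q)"
  shows "P (p :: ('k::field, 'n) coord_ring)"
proof (induction p rule: poly_mapping_single_add_induct)
  case zero
  show ?case using const[of 0] by simp
next
  case (single_add p e c)
  have monom: "P (Poly_Mapping.single e (1::'k))" for e :: "'n \<Rightarrow>\<^sub>0 nat"
  proof (induction e rule: poly_mapping_single_add_induct)
    case zero
    show ?case using const[of 1] by (simp add: coord_const_def)
  next
    case (single_add e i d)
    have "P (Poly_Mapping.single (Poly_Mapping.single i d) (1::'k))"
    proof (induction d)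
      case 0
      show ?case using const[of 1] by (simp add: coord_const_def)
    next
      case (Suc d)
      have "Poly_Mapping.single (Poly_Mapping.single i (Suc d)) (1::'k)
          = coord_var i * Poly_Mapping.single (Poly_Mapping.single i d) 1"
        by (simp add: coord_var_def mult_single flip: Poly_Mapping.single_add)
      with Suc mult[OF var] show ?case by simp
    qed
    from mult[OF this single_add] show ?case by (simp add: mult_single)
  qed
  have "P (coord_const c * Poly_Mapping.single e 1)"
    by (intro mult const monom)
  then have "P (Poly_Mapping.single e c)" by (simp add: coord_const_def mult_single)
  with single_add add show ?case by blast
qed

lemma pullback_poly_compose:
  "pullback_poly N (pullback_poly M p) = pullback_poly (M ** N) p"
proof (induction p rule: coord_ring_induct)
  case (var j)
  have "transpose N *v (M $ j) = (M ** N) $ j"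
    by (simp add: vec_eq_iff matrix_vector_mult_def transpose_def matrix_matrix_mult_def mult.commute)
  then show ?case by (simp add: pullback_poly_linear_form)
qed (auto simp: pullback_poly_add pullback_poly_mult)

lemma pullback_poly_mat_1:
  fixes p :: "('k::field, 'n::finite) coord_ring"
  shows "pullback_poly (mat 1) p = p"
proof (induction p rule: coord_ring_induct)
  case (var j)
  have "mat 1 $ j = (axis j 1 :: 'k ^ 'n)"
    by (auto simp: mat_def axis_def vec_eq_iff)
  then show ?case by (simp add: linear_form_axis)
qed (auto simp: pullback_poly_add pullback_poly_mult)

section \<open>Constant terms under substitution\<close>

lemma lookup_linear_form_0 [simp]:
  fixes a :: "'k::field ^ 'n::finite"
  shows "Poly_Mapping.lookup (linear_form a) 0 = 0"
proof -
  have "Poly_Mapping.single i (Suc 0) \<noteq> 0" for i :: 'n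
    by (metis lookup_single_eq lookup_zero nat.distinct(1))
  then show ?thesis
    unfolding linear_form_def coord_const_mult_var
    by (auto simp: lookup_sum lookup_single when_def intro!: sum.neutral)
qed

lemma lookup_mult_0:
  "Poly_Mapping.lookup (p * q) 0 = Poly_Mapping.lookup p 0 * Poly_Mapping.lookup q 0"
  for p q :: "('k::field, 'n) coord_ring"
proof (induction p rule: poly_mapping_single_add_induct)
  case (single_add p e c)
  have "Poly_Mapping.lookup (Poly_Mapping.single e c * q) 0
      = Poly_Mapping.lookup (Poly_Mapping.single e c) 0 * Poly_Mapping.lookup q 0"
  proof (induction q rule: poly_mapping_single_add_induct)
    case (single_add q f d)
    have "e + f = 0 \<longleftrightarrow> e = 0 \<and> f = 0"
      by (auto simp: poly_mapping_eq_iff fun_eq_iff lookup_add)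
    with single_add show ?case
      by (auto simp: distrib_left mult_single lookup_add lookup_single when_def)
  qed simp
  with single_add show ?case by (simp add: lookup_add distrib_right)
qed simp

text \<open>A linear substitution fixes the origin and therefore keeps values there. Constant terms
  are residues modulo the maximal ideal of the origin, and generators are counted by these
  residues.\<close>

lemma lookup_pullback_poly_0 [simp]:
  "Poly_Mapping.lookup (pullback_poly M p) 0 = Poly_Mapping.lookup p 0"
proof (induction p rule: coord_ring_induct)
  case (var j)
  show ?case by (simp add: linear_form_axis[symmetric] pullback_poly_linear_form)
qed (auto simp: pullback_poly_add pullback_poly_mult lookup_add lookup_mult_0)

section \<open>Linear forms are prime\<close>

text \<open>Substituting \<open>x\<^sub>i - c\<^sub>i a(x)\<close> for \<open>x\<^sub>i\<close>, where \<open>a(c) = 1\<close>, has kernel generated by the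
  linear form \<open>a\<close>.\<close>

lemma linear_form_elimination:
  fixes a :: "'k::field ^ 'n::finite"
  assumes "a \<noteq> 0"
  obtains N :: "'k ^ 'n ^ 'n" where
    "\<And>p. linear_form a dvd p \<longleftrightarrow> pullback_poly N p = 0"
    "\<And>p. linear_form a dvd p - pullback_poly N p"
    "\<And>b. \<exists>t. pullback_poly N (linear_form b) = linear_form (b - t *s a)"
    "\<And>b k. a = axis k 1 \<Longrightarrow> pullback_poly N (linear_form b) = linear_form (b - (b $ k) *s a)"
proof -
  obtain k where k: "a $ k \<noteq> 0" using assms by (auto simp: vec_eq_iff)
  \<comment> \<open>The vector \<open>c\<close> is \<open>axis k (1 / a $ k)\<close>, so only the
    row \<open>k\<close> differs from the identity matrix. If \<open>a\<close> is itself a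
    coordinate, the substitution sets that coordinate to zero.\<close>
  define N :: "'k ^ 'n ^ 'n" where "N = (\<chi> i. axis i 1 - axis k (1 / a $ k) $ i *s a)"
  have N: "pullback_poly N (linear_form b) = linear_form (b - (b $ k / a $ k) *s a)" for b
  proof -
    have "transpose N *v b = b - (b $ k / a $ k) *s a"
    proof -
      have "(transpose N *v b) $ j = b $ j - (b $ k / a $ k) * a $ j" for j
      proof -
        have "(transpose N *v b) $ j
            = (\<Sum>i\<in>UNIV. (if i = j then b $ j else 0) - (if i = k then b $ k / a $ k * a $ j else 0))"
          unfolding matrix_vector_mult_def transpose_def
          by (auto simp: N_def axis_def algebra_simps intro!: sum.cong)
        then show ?thesis by (simp add: sum_subtractf)
      qed
      then show ?thesis by (simp add: vec_eq_iff)
    qed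
    then show ?thesis by (simp add: pullback_poly_linear_form)
  qed
  have dvd: "linear_form a dvd p - pullback_poly N p" for p
  proof (induction p rule: coord_ring_induct)
    case (var i)
    have "coord_var i - pullback_poly N (coord_var i) = linear_form ((axis i 1 $ k / a $ k) *s a)"
      unfolding linear_form_axis[symmetric] N
      by (simp add: linear_form_diff)
    then show ?case by (simp add: linear_form_smult)
  next
    case (add p q)
    have "p + q - pullback_poly N (p + q) = (p - pullback_poly N p) + (q - pullback_poly N q)"
      by (simp add: pullback_poly_add)
    with add show ?case by (metis dvd_add)
  next
    case (mult p q)
    have "p * q - pullback_poly N (p * q)
        = (p - pullback_poly N p) * q + pullback_poly N p * (q - pullback_poly N q)"
      by (simp add: pullback_poly_mult algebra_simps)
    with mult show ?case by (metis dvd_add dvd_mult dvd_mult2)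
  qed simp
  have "linear_form a dvd p \<longleftrightarrow> pullback_poly N p = 0" for p
  proof
    assume "linear_form a dvd p"
    then obtain q where "p = linear_form a * q" by blast
    moreover have "pullback_poly N (linear_form a) = 0" using k by (simp add: N)
    ultimately show "pullback_poly N p = 0" by (simp add: pullback_poly_mult)
  qed (use dvd[of p] in simp)
  moreover have "pullback_poly N (linear_form b) = linear_form (b - (b $ k') *s a)"
    if "a = axis k' 1" for b k'
  proof -
    have "k' = k" using k that by (auto simp: axis_def split: if_splits)
    then show ?thesis using that by (simp add: N)
  qed
  moreover have "\<exists>t. pullback_poly N (linear_form b) = linear_form (b - t *s a)" for b
    using N by blast
  ultimately show thesis using dvd by (intro that[of N])
qed

text \<open>The multiples of the form are the kernel of a ring homomorphism into an integral domain,
  and \<open>1\<close> is not in it.\<close>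

lemma prime_elem_linear_form:
  fixes a :: "'k::field ^ 'n::{finite,linorder}"
  assumes "a \<noteq> 0"
  shows "prime_elem (linear_form a)"
proof -
  obtain N :: "(('k, 'n) vec, 'n) vec" where N: "\<And>p. linear_form a dvd p \<longleftrightarrow> pullback_poly N p = 0"
    using linear_form_elimination[OF assms] by metis
  have "\<not> linear_form a dvd 1" by (simp add: N)
  with assms show ?thesis
    by (auto simp: prime_elem_def N pullback_poly_mult)
qed

lemma prime_elem_dvd_prod:
  "prime_elem p \<Longrightarrow> p dvd prod f T \<Longrightarrow> \<exists>x\<in>T. p dvd f x"
proof (induction T rule: infinite_finite_induct)
  case (insert x T)
  then show ?case by (metis insert_iff prime_elem_dvd_multD prod.insert)
qed (auto simp: prime_elem_def)

lemma linear_form_dvd_linear_form: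
  fixes a b :: "'k::field ^ 'n::finite"
  assumes "linear_form a dvd linear_form b"
  shows "\<exists>t. b = t *s a"
proof (cases "a = 0")
  case False
  obtain N :: "(('k, 'n) vec, 'n) vec" where N: "\<And>p. linear_form a dvd p \<longleftrightarrow> pullback_poly N p = 0"
    "\<And>b. \<exists>t. pullback_poly N (linear_form b) = linear_form (b - t *s a)"
    using linear_form_elimination[OF False] by metis
  from N(2)[of b] obtain t where "pullback_poly N (linear_form b) = linear_form (b - t *s a)"
    by blast
  with assms N(1) have "b - t *s a = 0" by simp
  then show ?thesis by (auto simp: algebra_simps)
qed (use assms in simp)

text \<open>Simplicity of an arrangement, expressed for covectors with an arbitrary index set. An
  arrangement and its section can then share one index set and differ only in the family of
  covectors.\<close>

definition nonparallel :: "'h set \<Rightarrow> ('h \<Rightarrow> 'k::field ^ 'n) \<Rightarrow> bool" where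
  "nonparallel I a \<longleftrightarrow> finite I \<and> (\<forall>h\<in>I. a h \<noteq> 0) \<and>
     (\<forall>h\<in>I. \<forall>h'\<in>I. h \<noteq> h' \<longrightarrow> (\<forall>t. a h \<noteq> t *s a h'))"

text \<open>The forms are pairwise nonassociate primes, so each further one must divide the cofactor
  left by the others. This reduces clearing the full denominator to one hyperplane at a
  time.\<close>

lemma prod_linear_forms_dvd:
  fixes a :: "'h \<Rightarrow> 'k::field ^ 'n::{finite,linorder}"
  assumes "nonparallel I a" "J \<subseteq> I" "\<And>h. h \<in> J \<Longrightarrow> linear_form (a h) dvd x"
  shows "(\<Prod>h\<in>J. linear_form (a h)) dvd x"
proof -
  have "finite J" using assms by (auto simp: nonparallel_def intro: finite_subset)
  then show ?thesis using assms(2,3)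
  proof (induction J)
    case (insert h J)
    then obtain y where y: "x = (\<Prod>h\<in>J. linear_form (a h)) * y" by blast
    have "h \<in> I" using insert by auto
    have prime: "prime_elem (linear_form (a h))"
      using assms(1) insert by (auto simp: nonparallel_def intro!: prime_elem_linear_form)
    have "\<not> linear_form (a h) dvd linear_form (a h')" if "h' \<in> J" for h'
    proof
      assume "linear_form (a h) dvd linear_form (a h')"
      then obtain t where "a h' = t *s a h" using linear_form_dvd_linear_form by blast
      moreover have "h' \<in> I" "h' \<noteq> h" using that insert by auto
      ultimately show False using assms(1) \<open>h \<in> I\<close> by (auto simp: nonparallel_def)
    qed
    then have "\<not> linear_form (a h) dvd (\<Prod>h\<in>J. linear_form (a h))"
      using prime_elem_dvd_prod[OF prime] by blast
    moreover have "linear_form (a h) dvd (\<Prod>h\<in>J. linear_form (a h)) * y"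
      using insert y by simp
    ultimately have "linear_form (a h) dvd y"
      using prime prime_elem_dvd_multD by blast
    then show ?case
      using insert(1,2) by (simp add: y mult.commute mult_dvd_mono)
  qed simp
qed

section \<open>Duality between logarithmic derivations and logarithmic forms\<close>

definition map_vec :: "('a \<Rightarrow> 'b) \<Rightarrow> 'a ^ 'n \<Rightarrow> 'b ^ 'n" where
  "map_vec f x = (\<chi> i. f (x $ i))"

lemma map_vec_nth [simp]: "map_vec f x $ i = f (x $ i)"
  by (simp add: map_vec_def)

definition covector_derivations ::
  "'h set \<Rightarrow> ('h \<Rightarrow> 'k::field ^ 'n::finite) \<Rightarrow> (('k, 'n) coord_ring ^ 'n) set" where
  "covector_derivations I a =
     {\<theta>. \<forall>h\<in>I. linear_form (a h) dvd scalar_product \<theta> (map_vec coord_const (a h))}"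

text \<open>For \<open>M = mat 1\<close> this is the dual of the module of derivations; in general it models the dual
  tensored with the coordinate ring of the section.\<close>

definition dual_forms ::
  "'k ^ 'm::{finite,linorder} ^ 'n \<Rightarrow> 'h set \<Rightarrow> ('h \<Rightarrow> 'k::field ^ 'n::finite) \<Rightarrow>
     (('k, 'm::{finite,linorder}) rat_fun ^ 'n) set" where
  "dual_forms M I a = {w. \<forall>\<theta>\<in>covector_derivations I a.
     scalar_product (map_vec (\<lambda>p. to_fract (pullback_poly M p)) \<theta>) w \<in> range to_fract}"

lemma log_derivations_eq: "log_derivations A = covector_derivations A defining_covector"
  by (simp add: log_derivations_def covector_derivations_def apply_derivation_def
      partial_deriv_linear_form scalar_product_def)

lemma range_to_fract_add: "x \<in> range to_fract \<Longrightarrow> y \<in> range to_fract \<Longrightarrow> x + y \<in> range to_fract"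
  by (auto simp flip: to_fract_add)

lemma range_to_fract_diff: "x \<in> range to_fract \<Longrightarrow> y \<in> range to_fract \<Longrightarrow> x - y \<in> range to_fract"
  by (auto simp flip: to_fract_diff)

lemma range_to_fract_mult: "x \<in> range to_fract \<Longrightarrow> y \<in> range to_fract \<Longrightarrow> x * y \<in> range to_fract"
  by (auto simp flip: to_fract_mult)

lemma range_to_fract_0 [simp]: "0 \<in> range to_fract"
  by (auto simp flip: to_fract_0)

lemma range_to_fract_sum: "(\<And>x. x \<in> T \<Longrightarrow> f x \<in> range to_fract) \<Longrightarrow> sum f T \<in> range to_fract"
  by (induction T rule: infinite_finite_induct) (auto intro!: range_to_fract_add)

lemma scalar_product_axis: "scalar_product (axis i x) v = x * v $ i"
proof -
  have "axis i x $ j * v $ j = (if j = i then x * v $ i else 0)" for j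
    by (simp add: axis_def)
  then show ?thesis by (simp add: scalar_product_def)
qed

lemma scalar_product_diff_left:
  "scalar_product (u - v) w = scalar_product u w - scalar_product v w"
  for u :: "'a::ring_1 ^ 'n"
  by (simp add: scalar_product_def left_diff_distrib sum_subtractf)

lemma map_vec_axis: "f 0 = 0 \<Longrightarrow> map_vec f (axis i x) = axis i (f x)"
  by (simp add: vec_eq_iff axis_def)

text \<open>The first kind of test derivation: pairing with it bounds the denominator of a dual form
  by the product of all the linear forms.\<close>

lemma axis_prod_in_covector_derivations:
  assumes "finite I"
  shows "axis i (\<Prod>h\<in>I. linear_form (a h)) \<in> covector_derivations I a"
  using assms by (auto simp: covector_derivations_def scalar_product_axis intro!: dvd_mult2 dvd_prodI)

text \<open>The second kind of test derivation: it annihilates \<open>a h\<close>, and the factor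
  \<open>q\<close> takes care of all other forms. Pairing with it yields the wedge condition at
  \<open>h\<close>. Together with the first kind it recovers the definition of logarithmic
  forms.\<close>

lemma rotation_in_covector_derivations:
  fixes a :: "'h \<Rightarrow> 'k::field ^ 'n::finite"
  assumes "finite I" "h \<in> I"
  defines "q \<equiv> \<Prod>h\<in>I - {h}. linear_form (a h)"
  shows "axis i (q * coord_const (a h $ j)) - axis j (q * coord_const (a h $ i))
    \<in> covector_derivations I a"
  unfolding covector_derivations_def mem_Collect_eq scalar_product_diff_left scalar_product_axis
    map_vec_nth
proof
  fix h' assume "h' \<in> I"
  show "linear_form (a h') dvd q * coord_const (a h $ j) * coord_const (a h' $ i) -
      q * coord_const (a h $ i) * coord_const (a h' $ j)"
  proof (cases "h' = h")
    case False
    then have "linear_form (a h') dvd q"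
      unfolding q_def using \<open>finite I\<close> \<open>h' \<in> I\<close> by (intro dvd_prodI) auto
    then show ?thesis by (simp add: mult.assoc)
  qed (simp add: mult_ac)
qed

lemma dual_formsD:
  "w \<in> dual_forms M I a \<Longrightarrow> \<theta> \<in> covector_derivations I a \<Longrightarrow>
    scalar_product (map_vec (\<lambda>p. to_fract (pullback_poly M p)) \<theta>) w \<in> range to_fract"
  by (simp add: dual_forms_def)

lemma dual_forms_regular:
  assumes "w \<in> dual_forms M I a" "finite I"
  shows "to_fract (pullback_poly M (\<Prod>h\<in>I. linear_form (a h))) * w $ i \<in> range to_fract"
  using dual_formsD[OF assms(1) axis_prod_in_covector_derivations[OF assms(2)], of i]
  by (simp add: map_vec_axis scalar_product_axis)

lemma dual_forms_wedge_regular: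
  assumes "w \<in> dual_forms M I a" "finite I" "h \<in> I"
  shows "to_fract (pullback_poly M (\<Prod>h\<in>I - {h}. linear_form (a h))) *
      (to_fract (coord_const (a h $ j)) * w $ i - to_fract (coord_const (a h $ i)) * w $ j)
    \<in> range to_fract"
proof -
  have "map_vec (\<lambda>p. to_fract (pullback_poly M p)) (axis i x - axis j y)
      = axis i (to_fract (pullback_poly M x)) - axis j (to_fract (pullback_poly M y))" for x y
    by (simp add: vec_eq_iff axis_def pullback_poly_diff)
  with dual_formsD[OF assms(1) rotation_in_covector_derivations[OF assms(2,3)], of i j]
  show ?thesis
    by (simp add: scalar_product_diff_left scalar_product_axis pullback_poly_mult
        right_diff_distrib mult.assoc)
qed

text \<open>Integrality may be checked at one \<open>h\<close> at a time. Modulo multiples of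
  \<open>linear_form (a h)\<close>, the wedge condition replaces \<open>a h $ j * w $ i\<close> by
  \<open>a h $ i * w $ j\<close> after multiplication by the full product. The pairing with
  \<open>\<theta>\<close> then becomes \<open>w $ j\<close> times the value of
  \<open>\<theta>\<close> on the form, which is divisible because \<open>\<theta>\<close> is
  logarithmic. The index \<open>j\<close> is chosen so that \<open>a h $ j\<close> is
  invertible.\<close>

lemma dual_formsI:
  fixes a :: "'h \<Rightarrow> 'k::field ^ 'n::{finite,linorder}"
  assumes "nonparallel I a"
    and reg: "\<And>i. to_fract (\<Prod>h\<in>I. linear_form (a h)) * w $ i \<in> range to_fract"
    and wedge: "\<And>h i j. h \<in> I \<Longrightarrow> to_fract (\<Prod>h\<in>I - {h}. linear_form (a h)) *
      (to_fract (coord_const (a h $ j)) * w $ i - to_fract (coord_const (a h $ i)) * w $ j)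
      \<in> range to_fract"
  shows "w \<in> dual_forms (mat 1) I a"
  unfolding dual_forms_def pullback_poly_mat_1
proof safe
  fix \<theta> assume \<theta>: "\<theta> \<in> covector_derivations I a"
  define Q where "Q = (\<Prod>h\<in>I. linear_form (a h))"
  have "finite I" using assms(1) by (simp add: nonparallel_def)
  then have "Q \<noteq> 0" using assms(1) by (auto simp: Q_def nonparallel_def)
  define v where "v = scalar_product (map_vec to_fract \<theta>) w"
  have "to_fract Q * v = (\<Sum>i\<in>UNIV. to_fract (\<theta> $ i) * (to_fract Q * w $ i))"
    by (simp add: v_def scalar_product_def sum_distrib_left mult_ac)
  also have "\<dots> \<in> range to_fract"
    unfolding Q_def by (intro range_to_fract_sum range_to_fract_mult[OF rangeI reg])
  finally obtain x where x: "to_fract Q * v = to_fract x" by auto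
  have "linear_form (a h) dvd x" if h: "h \<in> I" for h
  proof -
    define Qh where "Qh = (\<Prod>h\<in>I - {h}. linear_form (a h))"
    have Q: "Q = linear_form (a h) * Qh"
      using h \<open>finite I\<close> by (simp add: Q_def Qh_def prod.remove)
    from h assms(1) obtain j where j: "a h $ j \<noteq> 0" by (auto simp: nonparallel_def vec_eq_iff)
    obtain y where y: "\<And>i. to_fract Qh * (to_fract (coord_const (a h $ j)) * w $ i
        - to_fract (coord_const (a h $ i)) * w $ j) = to_fract (y i)"
      using wedge[OF h, of j] unfolding Qh_def image_iff by metis
    obtain z where z: "to_fract Q * w $ j = to_fract z"
      using reg unfolding Q_def by blast
    have "to_fract (coord_const (a h $ j) * x)
        = (\<Sum>i\<in>UNIV. to_fract (\<theta> $ i) * to_fract Q * (to_fract (coord_const (a h $ j)) * w $ i))"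
      by (simp add: x[symmetric] v_def scalar_product_def sum_distrib_left mult_ac)
    also have "\<dots> = (\<Sum>i\<in>UNIV. to_fract (\<theta> $ i) * to_fract (linear_form (a h)) * to_fract (y i)
        + to_fract (\<theta> $ i) * to_fract (coord_const (a h $ i)) * to_fract z)"
      by (intro sum.cong refl) (simp add: y[symmetric] z[symmetric] Q algebra_simps)
    also have "\<dots> = to_fract (linear_form (a h) * (\<Sum>i\<in>UNIV. \<theta> $ i * y i)
        + scalar_product \<theta> (map_vec coord_const (a h)) * z)"
      by (simp add: sum.distrib scalar_product_def sum_distrib_left sum_distrib_right mult_ac)
    finally have "coord_const (a h $ j) * x = linear_form (a h) * (\<Sum>i\<in>UNIV. \<theta> $ i * y i)
        + scalar_product \<theta> (map_vec coord_const (a h)) * z"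
      by (simp only: to_fract_eq_iff)
    moreover have "linear_form (a h) dvd scalar_product \<theta> (map_vec coord_const (a h))"
      using \<theta> h by (simp add: covector_derivations_def)
    ultimately have "linear_form (a h) dvd coord_const (a h $ j) * x" by simp
    then have "linear_form (a h) dvd coord_const (1 / a h $ j) * (coord_const (a h $ j) * x)"
      by (rule dvd_mult)
    also have "\<dots> = x" using j by (simp add: mult.assoc[symmetric] coord_const_mult[symmetric])
    finally show ?thesis .
  qed
  then have "Q dvd x"
    unfolding Q_def using assms(1) by (intro prod_linear_forms_dvd) auto
  then obtain y where "x = Q * y" by blast
  with x \<open>Q \<noteq> 0\<close> have "v = to_fract y" by simp
  then show "v \<in> range to_fract" by simp
qed

text \<open>Stated by covectors instead of dimensions, because this is how the hyperplanes of the
  section arise: as kernels of the restricted covectors.\<close>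

definition covector_arrangement :: "('k::field ^ 'n::finite) set set \<Rightarrow> bool" where
  "covector_arrangement A \<longleftrightarrow> finite A \<and> (\<forall>H\<in>A. \<exists>a. a \<noteq> 0 \<and> covector_kernel a = H)"

lemma covector_kernel_smult: "t \<noteq> 0 \<Longrightarrow> covector_kernel (t *s a) = covector_kernel a"
proof -
  have "(\<Sum>i\<in>UNIV. (t *s a) $ i * v $ i) = t * (\<Sum>i\<in>UNIV. a $ i * v $ i)" for v
    by (simp add: sum_distrib_left mult.assoc)
  then show "t \<noteq> 0 \<Longrightarrow> covector_kernel (t *s a) = covector_kernel a"
    by (simp add: covector_kernel_def)
qed

lemma covector_kernel_eq_UNIV_iff [simp]: "covector_kernel a = UNIV \<longleftrightarrow> a = 0"
proof
  assume "covector_kernel a = UNIV"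
  then have "axis i 1 \<in> covector_kernel a" for i by simp
  then have "a $ i = 0" for i
    by (simp add: covector_kernel_def axis_def if_distrib cong: if_cong)
  then show "a = 0" by (simp add: vec_eq_iff)
qed (simp add: covector_kernel_def)

lemma defining_covector:
  assumes "covector_arrangement A" "H \<in> A"
  shows "covector_kernel (defining_covector H) = H" "defining_covector H \<noteq> 0"
proof -
  obtain a where a: "a \<noteq> 0" "covector_kernel a = H"
    using assms by (auto simp: covector_arrangement_def)
  show eq: "covector_kernel (defining_covector H) = H"
    unfolding defining_covector_def using a(2) by (rule someI)
  then show "defining_covector H \<noteq> 0" using a by (metis covector_kernel_eq_UNIV_iff)
qed

lemma nonparallel_defining_covector:
  assumes "covector_arrangement A"
  shows "nonparallel A defining_covector"
proof -
  have "H = H'" if H: "H \<in> A" "H' \<in> A" "defining_covector H = t *s defining_covector H'" for H H' t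
  proof -
    have "t \<noteq> 0" using H defining_covector(2)[OF assms H(1)] by auto
    from covector_kernel_smult[OF this, of "defining_covector H'"]
    show ?thesis unfolding H(3)[symmetric] defining_covector(1)[OF assms H(1)]
        defining_covector(1)[OF assms H(2)] .
  qed
  then show ?thesis
    using assms defining_covector(2)[OF assms]
    by (auto simp: nonparallel_def covector_arrangement_def)
qed

lemma log_1_forms_eq:
  fixes A :: "('k::field ^ 'n::{finite,linorder}) set set"
  assumes "covector_arrangement A"
  shows "log_1_forms A = dual_forms (mat 1) A defining_covector"
proof -
  have np: "nonparallel A defining_covector"
    using nonparallel_defining_covector[OF assms] .
  then have fin: "finite A" by (simp add: nonparallel_def)
  define Q where "Q = defining_poly A"
  have Q0: "Q \<noteq> 0" using np by (auto simp: Q_def defining_poly_def nonparallel_def)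
  have Q: "Q = (\<Prod>h\<in>A. defining_form h)" by (simp add: Q_def defining_poly_def)
  have Qh: "Q = defining_form H * (\<Prod>h\<in>A - {H}. defining_form h)" if "H \<in> A" for H
    using that fin by (simp add: Q prod.remove)
  show ?thesis
  proof (intro Set.equalityI subsetI)
    fix \<omega> assume "\<omega> \<in> log_1_forms A"
    then obtain \<eta> where \<eta>: "\<eta> \<in> regular_1_forms" "\<omega> = (1 / to_fract Q) *s \<eta>"
      and wedge: "\<And>H. H \<in> A \<Longrightarrow> \<exists>w\<in>regular_2_forms.
            wedge \<omega> (differential (defining_form H)) =
              (\<chi> i j. to_fract (defining_form H) / to_fract Q * w $ i $ j)"
      by (auto simp: log_1_forms_def Q_def)
    show "\<omega> \<in> dual_forms (mat 1) A defining_covector"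
    proof (rule dual_formsI[OF np], fold Q)
      fix i
      show "to_fract Q * \<omega> $ i \<in> range to_fract"
        using \<eta> Q0 by (simp add: regular_1_forms_def)
    next
      fix H i j assume H: "H \<in> A"
      from wedge[OF H] obtain w where w: "w \<in> regular_2_forms"
        "wedge \<omega> (differential (defining_form H)) =
              (\<chi> i j. to_fract (defining_form H) / to_fract Q * w $ i $ j)" by blast
      let ?q = "\<Prod>h\<in>A - {H}. defining_form h"
      have "\<omega> $ i * to_fract (coord_const (defining_covector H $ j))
        - \<omega> $ j * to_fract (coord_const (defining_covector H $ i))
        = wedge \<omega> (differential (defining_form H)) $ i $ j"
        by (simp add: wedge_def differential_def partial_deriv_linear_form)
      also have "\<dots> = to_fract (defining_form H) / to_fract Q * w $ i $ j"
        unfolding w(2) by simp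
      finally have "to_fract ?q * (to_fract (coord_const (defining_covector H $ j)) * \<omega> $ i
            - to_fract (coord_const (defining_covector H $ i)) * \<omega> $ j)
          = to_fract ?q * (to_fract (defining_form H) / to_fract Q * w $ i $ j)"
        by (simp only: mult.commute[of "\<omega> $ _"])
      also have "\<dots> = to_fract ?q * to_fract (defining_form H) / to_fract Q * w $ i $ j"
        by simp
      also have "to_fract ?q * to_fract (defining_form H) / to_fract Q = 1"
        using Q0 unfolding Qh[OF H] by auto
      finally have eq: "to_fract ?q * (to_fract (coord_const (defining_covector H $ j)) * \<omega> $ i
            - to_fract (coord_const (defining_covector H $ i)) * \<omega> $ j) = w $ i $ j"
        by (simp only: mult_1_left)
      show "to_fract (\<Prod>h\<in>A - {H}. defining_form h)
          * (to_fract (coord_const (defining_covector H $ j)) * \<omega> $ i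
            - to_fract (coord_const (defining_covector H $ i)) * \<omega> $ j) \<in> range to_fract"
        unfolding eq using w(1) unfolding regular_2_forms_def by blast
    qed
  next
    fix \<omega> assume \<omega>: "\<omega> \<in> dual_forms (mat 1) A defining_covector"
    have "(\<chi> i. to_fract Q * \<omega> $ i) \<in> regular_1_forms"
      using dual_forms_regular[OF \<omega> fin] by (simp add: regular_1_forms_def pullback_poly_mat_1 Q)
    moreover have "\<omega> = (1 / to_fract Q) *s (\<chi> i. to_fract Q * \<omega> $ i)"
      using Q0 by (simp add: vec_eq_iff)
    moreover have "\<exists>w\<in>regular_2_forms. wedge \<omega> (differential (defining_form H)) =
              (\<chi> i j. to_fract (defining_form H) / to_fract Q * w $ i $ j)" if H: "H \<in> A" for H
    proof
      let ?q = "\<Prod>h\<in>A - {H}. defining_form h"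
      \<comment> \<open>The quotient of \<open>defining_form H\<close> by \<open>Q\<close> is the
        inverse of \<open>?q\<close>, so the required 2-form is the wedge product multiplied by
        \<open>?q\<close>.\<close>
      let ?w = "\<chi> i j. to_fract ?q * (to_fract (coord_const (defining_covector H $ j)) * \<omega> $ i
            - to_fract (coord_const (defining_covector H $ i)) * \<omega> $ j)"
      show "?w \<in> regular_2_forms"
        using dual_forms_wedge_regular[OF \<omega> fin H]
        unfolding pullback_poly_mat_1 regular_2_forms_def mem_Collect_eq vec_lambda_beta
        by (simp only: diff_self mult_zero_right minus_mult_right minus_diff_eq simp_thms)
      have "to_fract (defining_form H) / to_fract Q * to_fract ?q = 1"
        using Q0 unfolding Qh[OF H] by auto
      then have "to_fract (defining_form H) / to_fract Q * (to_fract ?q * y) = y" for y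
        by (simp only: mult.assoc[symmetric] mult_1_left)
      then show "wedge \<omega> (differential (defining_form H)) =
              (\<chi> i j. to_fract (defining_form H) / to_fract Q * ?w $ i $ j)"
        by (simp only: vec_eq_iff wedge_def differential_def partial_deriv_linear_form
            vec_lambda_beta mult.commute[of "\<omega> $ _"] simp_thms)
    qed
    ultimately show "\<omega> \<in> log_1_forms A"
      by (auto simp: log_1_forms_def Q_def)
  qed
qed

section \<open>Free modules of derivations and dual bases\<close>

lemma min_generators_le:
  "finite B \<Longrightarrow> module.span smul B = N \<Longrightarrow> min_generators smul N \<le> enat (card B)"
  unfolding min_generators_def by (rule INF_lower2[of B]) auto

lemma min_generators_ge:
  "(\<And>B. finite B \<Longrightarrow> module.span smul B = N \<Longrightarrow> c \<le> enat (card B)) \<Longrightarrow> c \<le> min_generators smul N"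
  unfolding min_generators_def by (rule INF_greatest) auto

lemma scalar_product_scale_left: "scalar_product (c *s u) v = c * scalar_product u v"
  for u :: "'a::semiring_1 ^ 'n"
  by (simp add: scalar_product_def sum_distrib_left mult.assoc)

lemma scalar_product_scale_right: "scalar_product u (c *s v) = c * scalar_product u v"
  for u :: "'a::comm_semiring_1 ^ 'n"
  by (simp add: scalar_product_def sum_distrib_left mult_ac)

lemma scalar_product_sum_left: "scalar_product (sum f T) v = (\<Sum>x\<in>T. scalar_product (f x) v)"
  for v :: "'a::semiring_1 ^ 'n"
  unfolding scalar_product_def sum_component sum_distrib_right by (rule sum.swap)

lemma scalar_product_sum_right: "scalar_product u (sum f T) = (\<Sum>x\<in>T. scalar_product u (f x))"
  for u :: "'a::semiring_1 ^ 'n"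
  unfolding scalar_product_def sum_component sum_distrib_left by (rule sum.swap)

lemma scalar_product_add_right: "scalar_product u (v + w) = scalar_product u v + scalar_product u w"
  for u :: "'a::semiring_1 ^ 'n"
  by (simp add: scalar_product_def distrib_left sum.distrib)

lemma scalar_product_diff_right: "scalar_product u (v - w) = scalar_product u v - scalar_product u w"
  for u :: "'a::ring_1 ^ 'n"
  by (simp add: scalar_product_def right_diff_distrib sum_subtractf)

lemma map_vec_pullback_combination:
  "map_vec (\<lambda>p. to_fract (pullback_poly M p)) (\<Sum>x\<in>T. c x *s f x)
   = (\<Sum>x\<in>T. to_fract (pullback_poly M (c x)) *s map_vec (\<lambda>p. to_fract (pullback_poly M p)) (f x))"
  by (simp add: vec_eq_iff pullback_poly_sum pullback_poly_mult)

lemma common_denominator: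
  fixes u :: "'b \<Rightarrow> 'a::idom fract"
  assumes "finite T"
  shows "\<exists>d. d \<noteq> 0 \<and> (\<forall>x\<in>T. to_fract d * u x \<in> range to_fract)"
  using assms
proof (induction T)
  case empty
  show ?case by (rule exI[of _ 1]) simp
next
  case (insert y T)
  then obtain d where d: "d \<noteq> 0" "\<forall>x\<in>T. to_fract d * u x \<in> range to_fract" by blast
  obtain b c where u: "u y = Fract b c" and c: "c \<noteq> 0" by (cases "u y")
  have "to_fract c * u y = to_fract b"
    using c by (simp add: u Fract_conv_to_fract)
  then have "to_fract c * u y \<in> range to_fract" by (simp only: rangeI)
  then have "to_fract d * (to_fract c * u y) \<in> range to_fract"
    by (rule range_to_fract_mult[OF rangeI])
  then have y: "to_fract (d * c) * u y \<in> range to_fract"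
    by (simp only: to_fract_mult mult.assoc)
  have x: "to_fract (d * c) * u x \<in> range to_fract" if "x \<in> T" for x
  proof -
    have "to_fract (d * c) * u x = to_fract c * (to_fract d * u x)"
      by (simp only: to_fract_mult mult_ac)
    then show ?thesis
      using range_to_fract_mult[OF rangeI bspec[OF d(2) that]] by (simp only:)
  qed
  have "d * c \<noteq> 0" using d c by simp
  with x y show ?case by blast
qed

text \<open>A relation over the fraction field becomes one over the ring when denominators are
  cleared. Bases of free submodules can thus be counted by dimension over a field.\<close>

lemma independent_map_to_fract:
  fixes B :: "('a::idom ^ 'n) set"
  assumes "\<not> module.dependent (*s) B"
  shows "vec.independent (map_vec to_fract ` B)"
proof
  interpret m: module "(*s) :: 'a \<Rightarrow> 'a ^ 'n \<Rightarrow> 'a ^ 'n" by (rule module_poly_vec)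
  have inj: "inj (map_vec to_fract :: 'a ^ 'n \<Rightarrow> _)"
    by (auto simp: inj_def vec_eq_iff)
  assume "vec.dependent (map_vec to_fract ` B)"
  then obtain t u v where t: "finite t" "t \<subseteq> map_vec to_fract ` B" "(\<Sum>v\<in>t. u v *s v) = 0"
    and v: "v \<in> t" "u v \<noteq> 0"
    unfolding vec.dependent_explicit by blast
  obtain t' where t': "t' \<subseteq> B" "t = map_vec to_fract ` t'"
    using t(2) by (meson subset_imageE)
  have fin: "finite t'" using t(1) t'(2) inj by (metis finite_imageD inj_on_subset subset_UNIV)
  obtain d p where d: "d \<noteq> 0" "\<forall>x\<in>t'. to_fract d * u (map_vec to_fract x) = to_fract (p x)"
    using common_denominator[OF fin, of "\<lambda>x. u (map_vec to_fract x)"]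
    unfolding image_iff by metis
  have "0 = to_fract d *s (\<Sum>v\<in>t. u v *s v)" using t by simp
  also have "\<dots> = to_fract d *s (\<Sum>x\<in>t'. u (map_vec to_fract x) *s map_vec to_fract x)"
    unfolding t'(2) using inj by (subst sum.reindex) (auto intro: inj_on_subset)
  also have "\<dots> = (\<Sum>x\<in>t'. to_fract (p x) *s map_vec to_fract x)"
    unfolding vec.scale_sum_right using d(2) by (intro sum.cong) auto
  also have "\<dots> = map_vec to_fract (\<Sum>x\<in>t'. p x *s x)"
    by (simp add: vec_eq_iff)
  finally have "map_vec to_fract (\<Sum>x\<in>t'. p x *s x) = 0" by (rule sym)
  moreover have "map_vec to_fract z = 0 \<Longrightarrow> z = 0" for z :: "'a ^ 'n"
    by (simp add: vec_eq_iff)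
  ultimately have "(\<Sum>x\<in>t'. p x *s x) = 0" by blast
  moreover obtain x where x: "x \<in> t'" "v = map_vec to_fract x" using v t' by blast
  have "p x \<noteq> 0" using d x v by force
  ultimately have "m.dependent B"
    unfolding m.dependent_explicit using fin t'(1) x(1) by blast
  with assms show False by simp
qed

text \<open>A basis stays independent over the fraction field, and it spans there because the module
  contains \<open>Q\<close> times every unit vector. Hence it has exactly \<open>CARD('n)\<close>
  elements and can be indexed by the coordinates. Only generation is recorded, since independence
  returns through the dual basis.\<close>

lemma free_covector_derivations_basis:
  fixes a :: "'h \<Rightarrow> 'k::field ^ 'n::{finite,linorder}"
  assumes "nonparallel I a" "free_submodule (*s) (covector_derivations I a)"
  obtains T :: "'n \<Rightarrow> (('k, 'n) coord_ring, 'n) vec" where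
    "\<And>i. T i \<in> covector_derivations I a"
    "\<And>\<theta>. \<theta> \<in> covector_derivations I a \<Longrightarrow> \<exists>r. \<theta> = (\<Sum>i\<in>UNIV. r i *s T i)"
proof -
  interpret m: module "(*s) :: ('k, 'n) coord_ring \<Rightarrow> (_, 'n) vec \<Rightarrow> _"
    by (rule module_poly_vec)
  define Q where "Q = (\<Prod>h\<in>I. linear_form (a h))"
  have fin: "finite I" and Q0: "Q \<noteq> 0" using assms(1) by (auto simp: nonparallel_def Q_def)
  obtain B where B: "\<not> m.dependent B" "m.span B = covector_derivations I a"
    using assms(2) by (auto simp: free_submodule_def)
  let ?\<tau> = "map_vec to_fract :: (('k, 'n) coord_ring, 'n) vec \<Rightarrow> (('k, 'n) rat_fun, 'n) vec"
  have ind: "vec.independent (?\<tau> ` B)" by (rule independent_map_to_fract[OF B(1)])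
  have inj: "inj_on ?\<tau> B" by (auto simp: inj_on_def vec_eq_iff)
  have finB: "finite B" using vec.finiteI_independent[OF ind] inj finite_image_iff by blast
  have expand: "\<exists>r. \<theta> = (\<Sum>b\<in>B. r b *s b)" if "\<theta> \<in> covector_derivations I a" for \<theta>
    using that unfolding B(2)[symmetric] m.span_finite[OF finB] by auto
  have "axis j 1 \<in> vec.span (?\<tau> ` B)" for j
  proof -
    obtain r where r: "axis j Q = (\<Sum>b\<in>B. r b *s b)"
      using expand axis_prod_in_covector_derivations[OF fin, of j a] unfolding Q_def by blast
    have "axis j 1 = (1 / to_fract Q) *s ?\<tau> (axis j Q)"
      using Q0 by (auto simp: vec_eq_iff axis_def)
    also have "?\<tau> (axis j Q) = (\<Sum>b\<in>B. to_fract (r b) *s ?\<tau> b)"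
      unfolding r by (simp add: vec_eq_iff)
    finally show ?thesis
      by (simp only:) (intro vec.span_scale vec.span_sum vec.span_base imageI)
  qed
  then have "cart_basis \<subseteq> vec.span (?\<tau> ` B)" by (auto simp: cart_basis_def)
  then have "vec.span (?\<tau> ` B) = UNIV"
    using vec.span_minimal[OF _ vec.subspace_span] span_cart_basis by blast
  moreover have "vec.dim (UNIV :: (('k, 'n) rat_fun, 'n) vec set) = CARD('n)"
    by (rule vec_dim_card)
  ultimately have "card (?\<tau> ` B) = CARD('n)"
    using vec.dim_span_eq_card_independent[OF ind] by (simp only:)
  then have "card B = CARD('n)" using card_image[OF inj] by simp
  then obtain T where T: "bij_betw T (UNIV :: 'n set) B"
    using finB finite_same_card_bij[of "UNIV :: 'n set" B] by auto
  show thesis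
  proof
    fix i show "T i \<in> covector_derivations I a"
      using T B(2) m.span_base by (metis bij_betwE UNIV_I)
  next
    fix \<theta> assume "\<theta> \<in> covector_derivations I a"
    then obtain r where r: "\<theta> = (\<Sum>b\<in>B. r b *s b)" using expand by blast
    have "\<theta> = (\<Sum>i\<in>UNIV. r (T i) *s T i)"
      unfolding r by (rule sum.reindex_bij_betw[OF T, symmetric])
    then show "\<exists>r. \<theta> = (\<Sum>i\<in>UNIV. r i *s T i)" by (rule exI[of _ "\<lambda>i. r (T i)"])
  qed
qed

text \<open>For fixed \<open>i\<close>, the vector with entries \<open>q j i / Q\<close> is the \<open>i\<close>-th element of the basis dual
  to \<open>T\<close>.\<close>

lemma free_dual_basis:
  fixes a :: "'h \<Rightarrow> 'k::field ^ 'n::{finite,linorder}"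
  assumes "nonparallel I a" "free_submodule (*s) (covector_derivations I a)"
  defines "Q \<equiv> \<Prod>h\<in>I. linear_form (a h)"
  obtains T :: "'n \<Rightarrow> (('k, 'n) coord_ring, 'n) vec" and q :: "'n \<Rightarrow> 'n \<Rightarrow> ('k, 'n) coord_ring" where
    "\<And>i. T i \<in> covector_derivations I a"
    "\<And>\<theta>. \<theta> \<in> covector_derivations I a \<Longrightarrow> \<exists>r. \<theta> = (\<Sum>i\<in>UNIV. r i *s T i)"
    "\<And>j. axis j Q = (\<Sum>i\<in>UNIV. q j i *s T i)"
    "\<And>i k. (\<Sum>j\<in>UNIV. T k $ j * q j i) = (if k = i then Q else 0)"
proof -
  have fin: "finite I" and Q0: "Q \<noteq> 0" using assms(1) by (auto simp: nonparallel_def Q_def)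
  obtain T :: "'n \<Rightarrow> (('k, 'n) coord_ring, 'n) vec" where T:
    "\<And>i. T i \<in> covector_derivations I a"
    "\<And>\<theta>. \<theta> \<in> covector_derivations I a \<Longrightarrow> \<exists>r. \<theta> = (\<Sum>i\<in>UNIV. r i *s T i)"
    by (rule free_covector_derivations_basis[OF assms(1,2)]) (rule that; assumption)
  have "\<forall>j. \<exists>r. axis j Q = (\<Sum>i\<in>UNIV. r i *s T i)"
    using T(2) axis_prod_in_covector_derivations[OF fin] unfolding Q_def by blast
  then obtain q where q: "\<And>j. axis j Q = (\<Sum>i\<in>UNIV. q j i *s T i)"
    by metis
  define T' :: "((('k, 'n) rat_fun, 'n) vec, 'n) vec" where "T' = (\<chi> i j. to_fract (T i $ j))"
  define q' :: "((('k, 'n) rat_fun, 'n) vec, 'n) vec" where "q' = (\<chi> j i. to_fract (q j i) / to_fract Q)"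
  have "q' ** T' = mat 1"
  proof -
    have "(q' ** T') $ j $ l = mat 1 $ j $ l" for j l
    proof -
      have "(q' ** T') $ j $ l = to_fract (\<Sum>i\<in>UNIV. q j i * T i $ l) / to_fract Q"
        by (simp add: matrix_matrix_mult_def q'_def T'_def sum_divide_distrib)
      also have "(\<Sum>i\<in>UNIV. q j i * T i $ l) = axis j Q $ l"
        unfolding q by simp
      finally show ?thesis using Q0 by (simp add: axis_def mat_def)
    qed
    then show ?thesis by (simp add: vec_eq_iff)
  qed
  \<comment> \<open>The expansion of \<open>axis j Q\<close> gives one of the two inverse
    identities. For square matrices over the fraction field the other one follows, and it is the
    duality of the two bases.\<close>
  then have *: "T' ** q' = mat 1" by (simp add: matrix_left_right_inverse)
  have "(\<Sum>j\<in>UNIV. T k $ j * q j i) = (if k = i then Q else 0)" for i k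
  proof -
    have "to_fract (\<Sum>j\<in>UNIV. T k $ j * q j i) / to_fract Q = (T' ** q') $ k $ i"
      by (simp add: matrix_matrix_mult_def q'_def T'_def sum_divide_distrib)
    also have "\<dots> = (if k = i then 1 else 0)" unfolding * by (simp add: mat_def)
    finally have "to_fract (\<Sum>j\<in>UNIV. T k $ j * q j i) = to_fract (if k = i then Q else 0)"
      using Q0 by (auto simp: divide_eq_eq)
    then show ?thesis by (simp only: to_fract_eq_iff)
  qed
  with T q show thesis by (rule that)
qed

text \<open>Pairing \<open>w\<close> with \<open>Q\<close> times a unit vector, expanded in the
  \<open>T i\<close>, recovers \<open>w\<close> from its pairings with the
  \<open>T i\<close>.\<close>

lemma dual_forms_expand:
  assumes "axis j Q = (\<Sum>i\<in>UNIV. q j i *s T i)"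
  shows "to_fract (pullback_poly M Q) * w $ j = (\<Sum>i\<in>UNIV. to_fract (pullback_poly M (q j i))
      * scalar_product (map_vec (\<lambda>p. to_fract (pullback_poly M p)) (T i)) w)"
proof -
  have "to_fract (pullback_poly M Q) * w $ j
      = scalar_product (map_vec (\<lambda>p. to_fract (pullback_poly M p)) (axis j Q)) w"
    by (simp add: map_vec_axis scalar_product_axis)
  also have "\<dots> = (\<Sum>i\<in>UNIV. to_fract (pullback_poly M (q j i))
      * scalar_product (map_vec (\<lambda>p. to_fract (pullback_poly M p)) (T i)) w)"
    by (simp only: assms map_vec_pullback_combination scalar_product_sum_left scalar_product_scale_left)
  finally show ?thesis .
qed

lemma dual_formsI_generators:
  assumes "\<And>\<theta>. \<theta> \<in> covector_derivations I a \<Longrightarrow> \<exists>r. \<theta> = (\<Sum>i\<in>UNIV. r i *s T i)"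
    and "\<And>i::'n::finite. scalar_product (map_vec (\<lambda>p. to_fract (pullback_poly M p)) (T i)) w
          \<in> range to_fract"
  shows "w \<in> dual_forms M I a"
  unfolding dual_forms_def
proof safe
  fix \<theta> assume "\<theta> \<in> covector_derivations I a"
  then obtain r where r: "\<theta> = (\<Sum>i\<in>UNIV. r i *s T i)" using assms(1) by blast
  show "scalar_product (map_vec (\<lambda>p. to_fract (pullback_poly M p)) \<theta>) w \<in> range to_fract"
    unfolding r map_vec_pullback_combination scalar_product_sum_left scalar_product_scale_left
    by (intro range_to_fract_sum range_to_fract_mult[OF rangeI assms(2)])
qed

lemma dual_forms_add:
  "v \<in> dual_forms M I a \<Longrightarrow> w \<in> dual_forms M I a \<Longrightarrow> v + w \<in> dual_forms M I a"
  by (simp add: dual_forms_def scalar_product_add_right range_to_fract_add)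

lemma dual_forms_diff:
  "v \<in> dual_forms M I a \<Longrightarrow> w \<in> dual_forms M I a \<Longrightarrow> v - w \<in> dual_forms M I a"
  by (simp add: dual_forms_def scalar_product_diff_right range_to_fract_diff)

lemma dual_forms_scale:
  "w \<in> dual_forms M I a \<Longrightarrow> to_fract c *s w \<in> dual_forms M I a"
  by (simp add: dual_forms_def scalar_product_scale_right range_to_fract_mult)

lemma dual_forms_zero: "0 \<in> dual_forms M I a"
  by (simp add: dual_forms_def scalar_product_def)

lemma dual_forms_sum:
  "(\<And>x. x \<in> T \<Longrightarrow> f x \<in> dual_forms M I a) \<Longrightarrow> sum f T \<in> dual_forms M I a"
  by (induction T rule: infinite_finite_induct) (auto intro: dual_forms_add dual_forms_zero)

text \<open>The dual basis generates, which bounds the number of generators by the dimension of the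
  space. This is applied to the ambient arrangement and, towards a contradiction, to a section
  assumed free.\<close>

lemma free_dual_forms_span:
  fixes a :: "'h \<Rightarrow> 'k::field ^ 'n::{finite,linorder}"
  assumes "nonparallel I a" "free_submodule (*s) (covector_derivations I a)"
  obtains B where "finite B" "card B \<le> CARD('n)"
    "module.span rat_scale B = dual_forms (mat 1) I a"
proof -
  interpret m: module "rat_scale :: ('k, 'n) coord_ring \<Rightarrow> _" by (rule module_rat_scale)
  define Q where "Q = (\<Prod>h\<in>I. linear_form (a h))"
  have Q0: "Q \<noteq> 0" using assms(1) by (auto simp: nonparallel_def Q_def)
  obtain T :: "'n \<Rightarrow> (('k, 'n) coord_ring, 'n) vec" and q where T: "\<And>i. T i \<in> covector_derivations I a"
    "\<And>\<theta>. \<theta> \<in> covector_derivations I a \<Longrightarrow> \<exists>r. \<theta> = (\<Sum>i\<in>UNIV. r i *s T i)"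
    and q: "\<And>j. axis j Q = (\<Sum>i\<in>UNIV. q j i *s T i)"
    "\<And>i k. (\<Sum>j\<in>UNIV. T k $ j * q j i) = (if k = i then Q else 0)"
    by (rule free_dual_basis[OF assms], fold Q_def) (rule that; assumption)
  define W where "W i = (\<chi> j. to_fract (q j i) / to_fract Q)" for i
  have W: "W i \<in> dual_forms (mat 1) I a" for i
  proof (rule dual_formsI_generators[OF T(2)])
    fix k
    have "scalar_product (map_vec (\<lambda>p. to_fract (pullback_poly (mat 1) p)) (T k)) (W i)
        = to_fract (\<Sum>j\<in>UNIV. T k $ j * q j i) / to_fract Q"
      by (simp add: scalar_product_def W_def pullback_poly_mat_1 sum_divide_distrib)
    also have "\<dots> = to_fract (if k = i then 1 else 0)" unfolding q(2) using Q0 by simp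
    finally show "scalar_product (map_vec (\<lambda>p. to_fract (pullback_poly (mat 1) p)) (T k)) (W i)
      \<in> range to_fract" by simp
  qed
  have "m.span (range W) = dual_forms (mat 1) I a"
  proof
    have "m.subspace (dual_forms (mat 1) I a)"
      by (rule m.subspaceI) (auto simp: rat_scale_def intro: dual_forms_zero dual_forms_add dual_forms_scale)
    then show "m.span (range W) \<subseteq> dual_forms (mat 1) I a"
      using W by (intro m.span_minimal) auto
    show "dual_forms (mat 1) I a \<subseteq> m.span (range W)"
    proof
      fix w assume w: "w \<in> dual_forms (mat 1) I a"
      obtain s where s: "\<And>i. scalar_product (map_vec (\<lambda>p. to_fract (pullback_poly (mat 1) p)) (T i)) w
          = to_fract (s i)"
        using dual_formsD[OF w T(1)] unfolding image_iff by metis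
      have "w $ j = (\<Sum>i\<in>UNIV. rat_scale (s i) (W i)) $ j" for j
      proof -
        have eq: "to_fract Q * w $ j = (\<Sum>i\<in>UNIV. to_fract (q j i) * to_fract (s i))"
          using dual_forms_expand[of j Q q T "mat 1" w] q(1)
          by (simp add: pullback_poly_mat_1[abs_def] s[unfolded pullback_poly_mat_1])
        have "w $ j = (\<Sum>i\<in>UNIV. to_fract (q j i) * to_fract (s i)) / to_fract Q"
          unfolding eq[symmetric] using Q0 by simp
        then show ?thesis
          by (simp add: rat_scale_def W_def sum_divide_distrib mult.commute)
      qed
      then have "w = (\<Sum>i\<in>UNIV. rat_scale (s i) (W i))" by (simp add: vec_eq_iff)
      then show "w \<in> m.span (range W)"
        by (simp only:) (intro m.span_sum m.span_scale m.span_base rangeI)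
    qed
  qed
  moreover have "finite (range W)" "card (range W) \<le> CARD('n)"
    by (auto intro: card_image_le)
  ultimately show thesis using that by blast
qed

section \<open>Restriction of forms\<close>

text \<open>The linear half of \<open>pullback_1_form\<close>: the coefficients already live on the
  section, and only the differentials are restricted.\<close>

definition pull_vec :: "'k::field ^ 'p ^ 'q \<Rightarrow> ('k, 'm::{finite,linorder}) rat_fun ^ 'q \<Rightarrow>
    ('k, 'm) rat_fun ^ 'p" where
  "pull_vec M w = (\<chi> i. \<Sum>j\<in>UNIV. to_fract (coord_const (M $ j $ i)) * w $ j)"

lemma pull_vec_nth: "pull_vec M w $ i = (\<Sum>j\<in>UNIV. to_fract (coord_const (M $ j $ i)) * w $ j)"
  by (simp add: pull_vec_def)

lemma pull_vec_add: "pull_vec M (v + w) = pull_vec M v + pull_vec M w"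
  by (simp add: vec_eq_iff pull_vec_nth distrib_left sum.distrib)

lemma pull_vec_diff: "pull_vec M (v - w) = pull_vec M v - pull_vec M w"
  by (simp add: vec_eq_iff pull_vec_nth right_diff_distrib sum_subtractf)

lemma pull_vec_scale: "pull_vec M (c *s w) = c *s pull_vec M w"
  by (simp add: vec_eq_iff pull_vec_nth sum_distrib_left mult.left_commute)

lemma pull_vec_zero [simp]: "pull_vec M 0 = 0"
  by (simp add: vec_eq_iff pull_vec_nth)

lemma pull_vec_sum: "pull_vec M (sum f T) = (\<Sum>x\<in>T. pull_vec M (f x))"
  by (induction T rule: infinite_finite_induct) (auto simp: pull_vec_add)

lemma pull_vec_compose: "pull_vec N (pull_vec M w) = pull_vec (M ** N) w"
proof -
  have "pull_vec N (pull_vec M w) $ i = pull_vec (M ** N) w $ i" for i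
  proof -
    have "pull_vec N (pull_vec M w) $ i = (\<Sum>j\<in>UNIV. \<Sum>l\<in>UNIV.
        to_fract (coord_const (M $ l $ j * N $ j $ i)) * w $ l)"
      unfolding pull_vec_nth sum_distrib_left
      by (intro sum.cong refl) (simp only: coord_const_mult to_fract_mult mult_ac)
    also have "\<dots> = (\<Sum>l\<in>UNIV. \<Sum>j\<in>UNIV.
        to_fract (coord_const (M $ l $ j * N $ j $ i)) * w $ l)"
      by (rule sum.swap)
    also have "\<dots> = pull_vec (M ** N) w $ i"
      by (simp add: pull_vec_nth matrix_matrix_mult_def coord_const_sum sum_distrib_right)
    finally show ?thesis .
  qed
  then show ?thesis by (simp add: vec_eq_iff)
qed

lemma pull_vec_mat_1 [simp]: "pull_vec (mat 1) w = w"
proof -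
  have "to_fract (coord_const (if j = i then 1 else 0)) * w $ j = (if j = i then w $ i else 0)" for i j
    by simp
  then have "pull_vec (mat 1) w $ i = w $ i" for i
    by (simp only: pull_vec_nth mat_def vec_lambda_beta sum.delta finite_class.finite_UNIV UNIV_I if_True)
  then show ?thesis by (simp add: vec_eq_iff)
qed

text \<open>The adjoint of \<open>pull_vec\<close>: it pushes vector fields forward along the linear
  map \<open>M\<close>.\<close>

definition push_vec :: "'k::field ^ 'p ^ 'q \<Rightarrow> ('k, 'm) coord_ring ^ 'p \<Rightarrow> ('k, 'm) coord_ring ^ 'q" where
  "push_vec M \<theta> = (\<chi> j. \<Sum>i\<in>UNIV. coord_const (M $ j $ i) * \<theta> $ i)"

lemma scalar_product_pull_vec:
  "scalar_product (map_vec to_fract \<theta>) (pull_vec M w)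
    = scalar_product (map_vec to_fract (push_vec M \<theta>)) w"
proof -
  have "scalar_product (map_vec to_fract \<theta>) (pull_vec M w) = (\<Sum>i\<in>UNIV. \<Sum>j\<in>UNIV.
      to_fract (coord_const (M $ j $ i) * \<theta> $ i) * w $ j)"
    unfolding scalar_product_def pull_vec_nth sum_distrib_left map_vec_nth
    by (intro sum.cong refl) (simp only: to_fract_mult mult_ac)
  also have "\<dots> = (\<Sum>j\<in>UNIV. \<Sum>i\<in>UNIV. to_fract (coord_const (M $ j $ i) * \<theta> $ i) * w $ j)"
    by (rule sum.swap)
  also have "\<dots> = scalar_product (map_vec to_fract (push_vec M \<theta>)) w"
    by (simp add: scalar_product_def push_vec_def sum_distrib_right)
  finally show ?thesis .
qed

lemma scalar_product_push_vec:
  "scalar_product (push_vec M \<theta>) (map_vec coord_const b)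
    = scalar_product \<theta> (map_vec coord_const (transpose M *v b))"
proof -
  have "scalar_product (push_vec M \<theta>) (map_vec coord_const b)
      = (\<Sum>j\<in>UNIV. \<Sum>i\<in>UNIV. \<theta> $ i * coord_const (M $ j $ i * b $ j))"
    by (simp add: scalar_product_def push_vec_def sum_distrib_right sum_distrib_left coord_const_mult mult_ac)
  also have "\<dots> = (\<Sum>i\<in>UNIV. \<Sum>j\<in>UNIV. \<theta> $ i * coord_const (M $ j $ i * b $ j))"
    by (rule sum.swap)
  also have "\<dots> = scalar_product \<theta> (map_vec coord_const (transpose M *v b))"
    by (simp add: scalar_product_def matrix_vector_mult_def transpose_def coord_const_sum
        sum_distrib_left)
  finally show ?thesis .
qed

lemma dual_forms_regularI:
  assumes "\<And>i. w $ i \<in> range to_fract"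
  shows "w \<in> dual_forms M I a"
  unfolding dual_forms_def scalar_product_def mem_Collect_eq map_vec_nth
  by (intro ballI range_to_fract_sum range_to_fract_mult[OF rangeI assms])

text \<open>The only consequence of the exactness of the Koszul complex on three variables that is
  needed.\<close>

lemma var_ideal_saturated:
  fixes p :: "('k::field, 'm::{finite,linorder}) coord_ring"
  assumes "i \<noteq> j" "i \<noteq> k" "j \<noteq> k"
    and "coord_var k * p = coord_var j * q - coord_var i * r"
  obtains u v where "p = coord_var j * u - coord_var i * v"
proof -
  have nz: "axis l 1 \<noteq> (0 :: ('k, 'm) vec)" for l by (simp add: axis_eq_0_iff)
  obtain N1 :: "(('k, 'm) vec, 'm) vec" where N1:
    "\<And>p. linear_form (axis i 1) dvd p - pullback_poly N1 p"
    "\<And>b k. axis i 1 = axis k (1::'k) \<Longrightarrow> pullback_poly N1 (linear_form b) = linear_form (b - (b $ k) *s axis i 1)"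
    using linear_form_elimination[OF nz[of i]] by metis
  obtain N2 :: "(('k, 'm) vec, 'm) vec" where N2:
    "\<And>p. linear_form (axis j 1) dvd p \<longleftrightarrow> pullback_poly N2 p = 0"
    "\<And>b k. axis j 1 = axis k (1::'k) \<Longrightarrow> pullback_poly N2 (linear_form b) = linear_form (b - (b $ k) *s axis j 1)"
    using linear_form_elimination[OF nz[of j]] by metis
  have v1: "pullback_poly N1 (linear_form (axis l 1)) = (if l = i then 0 else linear_form (axis l 1))" for l
    unfolding N1(2)[OF refl] by (auto simp: axis_def)
  have v2: "pullback_poly N2 (linear_form (axis l 1)) = (if l = j then 0 else linear_form (axis l 1))" for l
    unfolding N2(2)[OF refl] by (auto simp: axis_def)
  note var = linear_form_axis[where 'k='k and 'n='m, symmetric]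
  \<comment> \<open>Setting the variables \<open>i\<close> and \<open>j\<close> to zero kills the
    right-hand side of the relation but keeps \<open>coord_var k\<close>, so \<open>p\<close> itself
    must vanish there.\<close>
  have "pullback_poly N2 (pullback_poly N1 (coord_var k * p))
      = pullback_poly N2 (pullback_poly N1 (coord_var j * q - coord_var i * r))"
    by (simp only: assms(4))
  then have "coord_var k * pullback_poly N2 (pullback_poly N1 p) = 0"
    unfolding var using assms(1-3) by (simp add: pullback_poly_mult pullback_poly_diff v1 v2)
  moreover have "coord_var k \<noteq> (0 :: ('k, 'm) coord_ring)"
    unfolding var using nz by simp
  ultimately have "pullback_poly N2 (pullback_poly N1 p) = 0" by simp
  then have "coord_var j dvd pullback_poly N1 p" using N2(1) unfolding var by blast
  then obtain u where u: "pullback_poly N1 p = coord_var j * u" by blast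
  obtain v where v: "p - pullback_poly N1 p = coord_var i * v" using N1(1)[of p] unfolding var by blast
  have "p = coord_var j * u - coord_var i * (- v)" using u v by (simp add: algebra_simps)
  then show thesis by (rule that)
qed

text \<open>Genericity enters these assumptions only as nonparallelism of the restricted covectors.
  \<open>L\<close> is some projection onto the section that need not respect any hyperplane. It
  serves to lift polynomials and to split off the kernel of \<open>pull_vec M\<close>.\<close>

locale arrangement_section =
  fixes I :: "'h set" and a :: "'h \<Rightarrow> 'k::field ^ 'n::{finite,linorder}"
    and M :: "'k ^ 'm::{finite,linorder} ^ 'n::{finite,linorder}"
    and L :: "'k ^ 'n::{finite,linorder} ^ 'm::{finite,linorder}"
  assumes nonparallel: "nonparallel I a"
    and nonparallel_section: "nonparallel I (\<lambda>h. transpose M *v a h)"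
    and left_inverse: "L ** M = mat 1"
begin

definition b :: "'h \<Rightarrow> 'k ^ 'm::{finite,linorder}" where "b h = transpose M *v a h"

definition U :: "(('k, 'm) rat_fun ^ 'n::{finite,linorder}) set" where "U = dual_forms M I a"

definition V :: "(('k, 'm) rat_fun ^ 'm::{finite,linorder}) set" where "V = dual_forms (mat 1) I b"

lemma fin: "finite I"
  using nonparallel by (simp add: nonparallel_def)

lemma nonparallel_b: "nonparallel I b"
  using nonparallel_section by (simp add: b_def[abs_def])

lemma pullback_linear_form: "pullback_poly M (linear_form (a h)) = linear_form (b h)"
  by (simp add: pullback_poly_linear_form b_def)

lemma pullback_prod: "pullback_poly M (\<Prod>h\<in>J. linear_form (a h)) = (\<Prod>h\<in>J. linear_form (b h))"
  by (simp add: pullback_poly_prod pullback_linear_form)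

lemma b_nth: "b h $ k = (\<Sum>i\<in>UNIV. M $ i $ k * a h $ i)"
  by (simp add: b_def matrix_vector_mult_def transpose_def)

text \<open>Contracting a wedge product with a vector tangent to the section.\<close>

lemma wedge_contract:
  assumes "w \<in> U" "h \<in> I"
  shows "to_fract (\<Prod>h\<in>I - {h}. linear_form (b h)) *
      (to_fract (coord_const (b h $ k)) * w $ j - to_fract (coord_const (a h $ j)) * pull_vec M w $ k)
    \<in> range to_fract"
proof -
  let ?q = "to_fract (\<Prod>h\<in>I - {h}. linear_form (b h))"
  let ?d = "\<lambda>i. ?q * (to_fract (coord_const (a h $ i)) * w $ j - to_fract (coord_const (a h $ j)) * w $ i)"
  have d: "?d i \<in> range to_fract" for i
    using dual_forms_wedge_regular[OF assms(1)[unfolded U_def] fin assms(2), of i j]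
    unfolding pullback_prod .
  then have "(\<Sum>i\<in>UNIV. to_fract (coord_const (M $ i $ k)) * ?d i) \<in> range to_fract"
    by (intro range_to_fract_sum range_to_fract_mult[OF rangeI d])
  also have "(\<Sum>i\<in>UNIV. to_fract (coord_const (M $ i $ k)) * ?d i)
      = (\<Sum>i\<in>UNIV. ?q * (to_fract (coord_const (M $ i $ k * a h $ i)) * w $ j)
        - ?q * (to_fract (coord_const (a h $ j)) * (to_fract (coord_const (M $ i $ k)) * w $ i)))"
    by (intro sum.cong refl)
      (simp only: coord_const_mult to_fract_mult right_diff_distrib mult_ac)
  also have "\<dots> = ?q * (to_fract (coord_const (b h $ k)) * w $ j)
      - ?q * (to_fract (coord_const (a h $ j)) * pull_vec M w $ k)"
    unfolding sum_subtractf sum_distrib_left[symmetric] sum_distrib_right[symmetric]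
      b_nth pull_vec_nth coord_const_sum to_fract_sum ..
  finally show ?thesis by (simp only: right_diff_distrib)
qed

lemma U_regular: "w \<in> U \<Longrightarrow> to_fract (\<Prod>h\<in>I. linear_form (b h)) * w $ j \<in> range to_fract"
  using dual_forms_regular[of w M I a j] fin by (simp add: U_def pullback_prod)

text \<open>The wedge condition on the section is the ambient one contracted with two tangent
  vectors, and \<open>wedge_contract\<close> provides the first contraction.\<close>

lemma pull_vec_in_V:
  assumes "w \<in> U"
  shows "pull_vec M w \<in> V"
  unfolding V_def
proof (rule dual_formsI[OF nonparallel_b])
  fix k
  let ?Q = "to_fract (\<Prod>h\<in>I. linear_form (b h))"
  have "?Q * pull_vec M w $ k = (\<Sum>j\<in>UNIV. to_fract (coord_const (M $ j $ k)) * (?Q * w $ j))"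
    unfolding pull_vec_nth sum_distrib_left by (intro sum.cong refl) (simp only: mult_ac)
  also have "\<dots> \<in> range to_fract"
    by (intro range_to_fract_sum range_to_fract_mult[OF rangeI U_regular[OF assms]])
  finally show "?Q * pull_vec M w $ k \<in> range to_fract" .
next
  fix h k l assume h: "h \<in> I"
  let ?q = "to_fract (\<Prod>h\<in>I - {h}. linear_form (b h))"
  let ?d = "\<lambda>j. ?q * (to_fract (coord_const (b h $ l)) * w $ j
    - to_fract (coord_const (a h $ j)) * pull_vec M w $ l)"
  have "(\<Sum>j\<in>UNIV. to_fract (coord_const (M $ j $ k)) * ?d j) \<in> range to_fract"
    by (intro range_to_fract_sum range_to_fract_mult[OF rangeI wedge_contract[OF assms h]])
  also have "(\<Sum>j\<in>UNIV. to_fract (coord_const (M $ j $ k)) * ?d j)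
      = (\<Sum>j\<in>UNIV. ?q * (to_fract (coord_const (b h $ l)) * (to_fract (coord_const (M $ j $ k)) * w $ j))
        - ?q * (to_fract (coord_const (M $ j $ k * a h $ j)) * pull_vec M w $ l))"
    by (intro sum.cong refl)
      (simp only: coord_const_mult to_fract_mult right_diff_distrib mult_ac)
  also have "\<dots> = ?q * (to_fract (coord_const (b h $ l)) * pull_vec M w $ k)
      - ?q * (to_fract (coord_const (b h $ k)) * pull_vec M w $ l)"
    unfolding sum_subtractf sum_distrib_left[symmetric] sum_distrib_right[symmetric]
      b_nth[of h k] pull_vec_nth[of M w k] coord_const_sum to_fract_sum ..
  finally show "?q * (to_fract (coord_const (b h $ l)) * pull_vec M w $ k
      - to_fract (coord_const (b h $ k)) * pull_vec M w $ l) \<in> range to_fract"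
    by (simp only: right_diff_distrib)
qed

text \<open>When the restriction vanishes, \<open>wedge_contract\<close> retains only the term with
  \<open>b h $ k\<close>. For a \<open>k\<close> where this constant is nonzero, it says that
  \<open>w\<close> has no pole along \<open>b h\<close>. Doing this for every \<open>h\<close>
  removes the whole denominator.\<close>

lemma kernel_regular:
  assumes "w \<in> U" "pull_vec M w = 0"
  shows "w $ j \<in> range to_fract"
proof -
  define Q where "Q = (\<Prod>h\<in>I. linear_form (b h))"
  have Q0: "Q \<noteq> 0" using nonparallel_b fin by (auto simp: Q_def nonparallel_def)
  obtain x where x: "to_fract Q * w $ j = to_fract x"
    using U_regular[OF assms(1), of j] unfolding Q_def by blast
  have "linear_form (b h) dvd x" if h: "h \<in> I" for h
  proof -
    define q where "q = (\<Prod>h\<in>I - {h}. linear_form (b h))"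
    have Q: "Q = linear_form (b h) * q" using h fin by (simp add: Q_def q_def prod.remove)
    obtain k where k: "b h $ k \<noteq> 0" using h nonparallel_b by (auto simp: nonparallel_def vec_eq_iff)
    obtain y where y: "to_fract q * (to_fract (coord_const (b h $ k)) * w $ j) = to_fract y"
      using wedge_contract[OF assms(1) h, of k j] unfolding assms(2) q_def by auto
    have "to_fract (coord_const (b h $ k) * x) = to_fract (coord_const (b h $ k)) * (to_fract Q * w $ j)"
      by (simp only: x to_fract_mult)
    also have "\<dots> = to_fract (linear_form (b h)) * (to_fract q * (to_fract (coord_const (b h $ k)) * w $ j))"
      by (simp only: Q to_fract_mult mult_ac)
    also have "\<dots> = to_fract (linear_form (b h) * y)" by (simp only: y to_fract_mult)
    finally have "coord_const (b h $ k) * x = linear_form (b h) * y" by (simp only: to_fract_eq_iff)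
    then have "coord_const (1 / b h $ k) * (coord_const (b h $ k) * x)
        = linear_form (b h) * (coord_const (1 / b h $ k) * y)" by simp
    moreover have "coord_const (1 / b h $ k) * (coord_const (b h $ k) * x) = x"
      using k by (simp add: mult.assoc[symmetric] coord_const_mult[symmetric])
    ultimately show ?thesis by (simp only: dvd_triv_left)
  qed
  then have "Q dvd x" unfolding Q_def by (intro prod_linear_forms_dvd[OF nonparallel_b]) auto
  then obtain y where y: "x = Q * y" by blast
  have "to_fract Q * w $ j = to_fract Q * to_fract y" by (simp only: x y to_fract_mult)
  then have "w $ j = to_fract y" using Q0 by simp
  then show ?thesis by (simp only: rangeI)
qed

section \<open>Surjectivity of restriction from \<open>U\<close> to \<open>V\<close>\<close>

lemma U_closed:
  "v \<in> U \<Longrightarrow> w \<in> U \<Longrightarrow> v + w \<in> U"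
  "v \<in> U \<Longrightarrow> w \<in> U \<Longrightarrow> v - w \<in> U"
  "w \<in> U \<Longrightarrow> to_fract c *s w \<in> U"
  unfolding U_def by (erule (1) dual_forms_add dual_forms_diff | erule dual_forms_scale)+

text \<open>The projection \<open>L'\<close> preserves the hyperplanes in \<open>J\<close>, so
  pulling \<open>\<eta>\<close> back along it creates no bad poles there, while \<open>f\<close>
  absorbs the remaining ones. By adjointness this amounts to \<open>f\<close> times the pushed
  derivation being logarithmic on the section.\<close>

lemma local_surjectivity:
  fixes L' :: "'k ^ 'n::{finite,linorder} ^ 'm::{finite,linorder}"
  assumes L': "L' ** M = mat 1" and J: "\<And>h. h \<in> J \<Longrightarrow> a h = transpose L' *v b h"
    and f: "\<And>h. h \<in> I - J \<Longrightarrow> linear_form (b h) dvd f" and \<eta>: "\<eta> \<in> V"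
  shows "to_fract f *s \<eta> \<in> pull_vec M ` U"
proof
  let ?w = "to_fract f *s pull_vec L' \<eta>"
  show "to_fract f *s \<eta> = pull_vec M ?w"
    by (simp add: pull_vec_scale pull_vec_compose L')
  show "?w \<in> U"
    unfolding U_def dual_forms_def
  proof safe
    fix \<theta> assume \<theta>: "\<theta> \<in> covector_derivations I a"
    let ?\<theta> = "map_vec (pullback_poly M) \<theta>"
    let ?\<theta>' = "f *s push_vec L' ?\<theta>"
    have "?\<theta>' \<in> covector_derivations I b"
      unfolding covector_derivations_def
    proof safe
      fix h assume h: "h \<in> I"
      show "linear_form (b h) dvd scalar_product ?\<theta>' (map_vec coord_const (b h))"
      proof (cases "h \<in> J")
        case True
        have "scalar_product (push_vec L' ?\<theta>) (map_vec coord_const (b h))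
            = scalar_product ?\<theta> (map_vec coord_const (a h))"
          by (simp only: scalar_product_push_vec J[OF True, symmetric])
        also have "\<dots> = pullback_poly M (scalar_product \<theta> (map_vec coord_const (a h)))"
          by (simp add: scalar_product_def pullback_poly_sum pullback_poly_mult)
        finally have eq: "scalar_product (push_vec L' ?\<theta>) (map_vec coord_const (b h))
            = pullback_poly M (scalar_product \<theta> (map_vec coord_const (a h)))" .
        have "linear_form (a h) dvd scalar_product \<theta> (map_vec coord_const (a h))"
          using \<theta> h by (simp add: covector_derivations_def)
        then have "linear_form (b h) dvd pullback_poly M (scalar_product \<theta> (map_vec coord_const (a h)))"
          by (auto elim!: dvdE simp: pullback_poly_mult pullback_linear_form)
        then show ?thesis by (simp add: scalar_product_scale_left eq)
      next
        case False
        then show ?thesis using f h by (simp add: scalar_product_scale_left)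
      qed
    qed
    from dual_formsD[OF \<eta>[unfolded V_def] this]
    have "scalar_product (map_vec to_fract ?\<theta>') \<eta> \<in> range to_fract"
      by (simp add: pullback_poly_mat_1)
    also have "map_vec to_fract ?\<theta>' = to_fract f *s map_vec to_fract (push_vec L' ?\<theta>)"
      by (simp add: vec_eq_iff)
    also have "scalar_product \<dots> \<eta> = scalar_product (map_vec to_fract ?\<theta>) ?w"
      by (simp only: scalar_product_scale_left scalar_product_scale_right scalar_product_pull_vec)
    also have "map_vec to_fract ?\<theta> = map_vec (\<lambda>p. to_fract (pullback_poly M p)) \<theta>"
      by (simp add: vec_eq_iff)
    finally show "scalar_product (map_vec (\<lambda>p. to_fract (pullback_poly M p)) \<theta>) ?w \<in> range to_fract" .
  qed
qed

text \<open>If lifts of \<open>x *s \<eta>\<close> and \<open>y *s \<eta>\<close> satisfied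
  \<open>y *s w1 = x *s w2\<close> exactly, then \<open>w1\<close> divided by \<open>x\<close> would
  lift \<open>\<eta>\<close>. The defect \<open>d\<close> is regular by
  \<open>kernel_regular\<close>. The third lift puts \<open>z\<close> times \<open>d\<close> into
  the ideal of \<open>x\<close> and \<open>y\<close>, hence \<open>d\<close> lies there too and can
  be absorbed into \<open>w1\<close> and \<open>w2\<close>.\<close>

lemma three_variables_surjectivity:
  assumes ij: "i \<noteq> j" "i \<noteq> k" "j \<noteq> k"
    and "\<And>l. l \<in> {i, j, k} \<Longrightarrow> to_fract (coord_var l) *s \<eta> \<in> pull_vec M ` U"
  shows "\<eta> \<in> pull_vec M ` U"
proof -
  define x y z :: "('k, 'm) rat_fun" where
    xyz: "x = to_fract (coord_var i)" "y = to_fract (coord_var j)" "z = to_fract (coord_var k)"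
  have ex: "\<exists>w\<in>U. pull_vec M w = to_fract (coord_var l) *s \<eta>" if "l \<in> {i, j, k}" for l
    using assms(4)[OF that] by (auto simp only: image_iff)
  obtain w1 where w1: "w1 \<in> U" "pull_vec M w1 = x *s \<eta>" using ex[of i] unfolding xyz by blast
  obtain w2 where w2: "w2 \<in> U" "pull_vec M w2 = y *s \<eta>" using ex[of j] unfolding xyz by blast
  obtain w3 where w3: "w3 \<in> U" "pull_vec M w3 = z *s \<eta>" using ex[of k] unfolding xyz by blast
  note w = w1 w2 w3
  define d where "d = y *s w1 - x *s w2"
  have syzygy: "(c1 *s w - c2 *s v) $ l \<in> range to_fract"
    if "w \<in> U" "v \<in> U" "pull_vec M w = c2 *s \<eta>" "pull_vec M v = c1 *s \<eta>"
      "c1 \<in> range to_fract" "c2 \<in> range to_fract" for c1 c2 w v l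
  proof (rule kernel_regular)
    show "c1 *s w - c2 *s v \<in> U" using that U_closed by blast
    show "pull_vec M (c1 *s w - c2 *s v) = 0"
      by (simp only: pull_vec_diff pull_vec_scale that vec.scale_scale mult.commute[of c1] diff_self)
  qed
  have reg: "d $ l \<in> range to_fract" "(z *s w1 - x *s w3) $ l \<in> range to_fract"
    "(z *s w2 - y *s w3) $ l \<in> range to_fract" for l
    unfolding d_def by (rule syzygy; (rule w)?; simp add: xyz)+
  have rel: "z * d $ l = y * (z *s w1 - x *s w3) $ l - x * (z *s w2 - y *s w3) $ l" for l
    unfolding d_def vector_minus_component vector_smult_component by (simp only: algebra_simps)
  have "\<forall>l. \<exists>u v. d $ l = y * to_fract u - x * to_fract v"
  proof
    fix l
    obtain p q r where pqr: "d $ l = to_fract p" "(z *s w1 - x *s w3) $ l = to_fract q"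
      "(z *s w2 - y *s w3) $ l = to_fract r" using reg[of l] by blast
    have "to_fract (coord_var k * p) = to_fract (coord_var j * q - coord_var i * r)"
      using rel[of l] unfolding pqr by (simp only: xyz to_fract_mult to_fract_diff)
    then have "coord_var k * p = coord_var j * q - coord_var i * r"
      by (simp only: to_fract_eq_iff)
    from var_ideal_saturated[OF ij this] obtain u v where "p = coord_var j * u - coord_var i * v" .
    then show "\<exists>u v. d $ l = y * to_fract u - x * to_fract v"
      unfolding pqr xyz by (intro exI[of _ u] exI[of _ v]) (simp only: to_fract_mult to_fract_diff)
  qed
  then obtain u v where uv: "\<And>l. d $ l = y * to_fract (u l) - x * to_fract (v l)" by metis
  define v1 v2 :: "(('k, 'm) rat_fun, 'n) vec" where
    "v1 = (\<chi> l. to_fract (u l))" and "v2 = (\<chi> l. to_fract (v l))"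
  have d: "d = y *s v1 - x *s v2" by (simp only: vec_eq_iff vector_minus_component
        vector_smult_component v1_def v2_def vec_lambda_beta uv simp_thms)
  \<comment> \<open>The corrections must restrict to zero, as otherwise \<open>w1\<close> and
    \<open>w2\<close> would no longer be lifts. This projection onto the kernel of
    \<open>pull_vec M\<close> fixes \<open>d\<close>, so it can be applied to \<open>v1\<close> and
    \<open>v2\<close> without disturbing the identity.\<close>
  define proj where "proj w = w - pull_vec L (pull_vec M w)" for w :: "(('k, 'm) rat_fun, 'n) vec"
  have pull_proj: "pull_vec M (proj w) = 0" for w
    by (simp only: proj_def pull_vec_diff pull_vec_compose[of M L "pull_vec M w"] left_inverse
        pull_vec_mat_1 diff_self)
  have "pull_vec M d = 0"
    unfolding d_def by (simp only: pull_vec_diff pull_vec_scale w vec.scale_scale mult.commute[of y] diff_self)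
  then have "d = proj d" by (simp add: proj_def)
  also have "\<dots> = y *s proj v1 - x *s proj v2"
    by (simp only: d proj_def pull_vec_diff pull_vec_scale vec.scale_right_diff_distrib)
       (simp only: algebra_simps)
  finally have d_proj: "y *s w1 - x *s w2 = y *s proj v1 - x *s proj v2" by (simp only: d_def)
  have proj_U: "proj w \<in> U" if "\<And>l. w $ l \<in> range to_fract" for w
    unfolding U_def
  proof (rule dual_forms_regularI)
    fix l
    show "proj w $ l \<in> range to_fract"
      unfolding proj_def pull_vec_nth vector_minus_component
      by (intro range_to_fract_diff range_to_fract_sum range_to_fract_mult[OF rangeI] that)
  qed
  define u1 u2 where "u1 = w1 - proj v1" and "u2 = w2 - proj v2"
  have u12: "u1 \<in> U" "u2 \<in> U"
    unfolding u1_def u2_def v1_def v2_def by (intro U_closed w proj_U; simp)+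
  have rearrange: "(A - B) - (C - D) = (A - C) - (B - D)" for A B C D :: "(('k, 'm) rat_fun, 'n) vec"
    by (simp add: algebra_simps)
  have "y *s u1 - x *s u2 = (y *s w1 - x *s w2) - (y *s proj v1 - x *s proj v2)"
    by (simp only: u1_def u2_def vec.scale_right_diff_distrib rearrange[of "y *s w1"])
  then have yu: "y *s u1 = x *s u2" by (simp only: d_proj diff_self right_minus_eq)
  have ax: "axis l (1::'k) \<noteq> 0" for l :: 'm by (simp add: axis_eq_0_iff)
  have x0: "x \<noteq> 0" unfolding xyz(1) linear_form_axis[where 'k='k and 'n='m, symmetric]
    using ax by simp
  \<comment> \<open>Membership in \<open>U\<close> is tested by pairings. There \<open>y\<close>
    times one polynomial equals \<open>x\<close> times another, and the prime \<open>x\<close> does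
    not divide \<open>y\<close>.\<close>
  have "(1 / x) *s u1 \<in> U"
    unfolding U_def dual_forms_def
  proof safe
    fix \<theta> assume \<theta>: "\<theta> \<in> covector_derivations I a"
    let ?p = "scalar_product (map_vec (\<lambda>p. to_fract (pullback_poly M p)) \<theta>)"
    obtain r1 r2 where r: "?p u1 = to_fract r1" "?p u2 = to_fract r2"
      using dual_formsD[OF _ \<theta>] u12 unfolding U_def by blast
    have "y * ?p u1 = x * ?p u2"
      by (simp only: scalar_product_scale_right[symmetric] yu)
    then have "to_fract (coord_var j * r1) = to_fract (coord_var i * r2)"
      by (simp only: r xyz to_fract_mult)
    then have "linear_form (axis j 1) * r1 = linear_form (axis i 1) * r2"
      by (simp only: to_fract_eq_iff linear_form_axis)
    then have "linear_form (axis i 1) dvd linear_form (axis j 1) * r1" by (rule dvdI)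
    moreover have "\<not> linear_form (axis i (1::'k)) dvd linear_form (axis j 1)"
    proof
      assume "linear_form (axis i (1::'k)) dvd linear_form (axis j 1)"
      then obtain t where "axis j (1::'k) = t *s axis i 1" using linear_form_dvd_linear_form by blast
      then have "axis j (1::'k) $ j = t * axis i 1 $ j" by simp
      then show False using ij(1) by (simp add: axis_def)
    qed
    ultimately have "linear_form (axis i 1) dvd r1"
      using prime_elem_dvd_multD[OF prime_elem_linear_form[OF ax]] by blast
    then obtain r where r': "r1 = coord_var i * r" unfolding linear_form_axis by blast
    have "?p ((1 / x) *s u1) = (1 / x) * (x * to_fract r)"
      by (simp only: scalar_product_scale_right r(1) r' to_fract_mult xyz(1))
    also have "\<dots> = to_fract r" using x0 by simp
    finally show "?p ((1 / x) *s u1) \<in> range to_fract" by (simp only: rangeI)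
  qed
  moreover have "pull_vec M ((1 / x) *s u1) = \<eta>"
    using x0 by (simp add: pull_vec_scale u1_def pull_vec_diff w pull_proj)
  ultimately show ?thesis by blast
qed

lemma V_closed:
  "v \<in> V \<Longrightarrow> w \<in> V \<Longrightarrow> v + w \<in> V"
  "w \<in> V \<Longrightarrow> to_fract c *s w \<in> V"
  "0 \<in> V"
  unfolding V_def by (erule (1) dual_forms_add | erule dual_forms_scale | rule dual_forms_zero)+

lemma image_U_add:
  assumes "v \<in> pull_vec M ` U" "w \<in> pull_vec M ` U"
  shows "v + w \<in> pull_vec M ` U"
proof -
  obtain v' w' where "v' \<in> U" "w' \<in> U" "v = pull_vec M v'" "w = pull_vec M w'" using assms by blast
  then show ?thesis by (intro image_eqI[of _ _ "v' + w'"] U_closed) (simp_all only: pull_vec_add)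
qed

lemma image_U_scale:
  assumes "w \<in> pull_vec M ` U"
  shows "to_fract c *s w \<in> pull_vec M ` U"
proof -
  obtain w' where "w' \<in> U" "w = pull_vec M w'" using assms by blast
  then show ?thesis
    by (intro image_eqI[of _ _ "to_fract c *s w'"] U_closed) (simp_all only: pull_vec_scale)
qed

text \<open>The covectors whose forms multiply \<open>\<eta>\<close> into the image make up a
  subspace. If it contains a spanning set, it contains all coordinates, in particular three distinct
  ones.\<close>

lemma span_surjectivity:
  assumes "vec.span (b ` J) = UNIV" "CARD('m) \<ge> 3"
    and J: "\<And>h. h \<in> J \<Longrightarrow> to_fract (linear_form (b h)) *s \<eta> \<in> pull_vec M ` U"
  shows "\<eta> \<in> pull_vec M ` U"
proof -
  define K where "K = {c. to_fract (linear_form c) *s \<eta> \<in> pull_vec M ` U}"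
  have "vec.subspace K"
  proof (rule vec.subspaceI)
    have "(0 :: (('k, 'm) rat_fun, 'n) vec) \<in> U" unfolding U_def by (rule dual_forms_zero)
    then have "0 \<in> pull_vec M ` U" using pull_vec_zero by (metis imageI)
    then show "0 \<in> K" by (simp add: K_def)
  next
    fix c d assume "c \<in> K" "d \<in> K"
    then show "c + d \<in> K"
      unfolding K_def mem_Collect_eq linear_form_add to_fract_add vec.scale_left_distrib
      by (rule image_U_add)
  next
    fix t c assume "c \<in> K"
    then show "t *s c \<in> K"
      unfolding K_def mem_Collect_eq linear_form_smult to_fract_mult vec.scale_scale[symmetric]
      by (rule image_U_scale)
  qed
  then have "vec.span (b ` J) \<subseteq> K" using J by (intro vec.span_minimal) (auto simp: K_def)
  then have K: "K = UNIV" using assms(1) by blast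
  obtain S :: "'m set" where "card S = 3" using obtain_subset_with_card_n[OF assms(2)] by blast
  then obtain i j k :: 'm where ijk: "i \<noteq> j" "i \<noteq> k" "j \<noteq> k" by (auto simp: card_3_iff)
  have "to_fract (coord_var l) *s \<eta> \<in> pull_vec M ` U" for l
  proof -
    have "axis l 1 \<in> K" using K by simp
    then show ?thesis by (simp only: K_def mem_Collect_eq linear_form_axis)
  qed
  with ijk show ?thesis by (rule three_variables_surjectivity)
qed

text \<open>The set of forms \<open>b h\<close> that multiply \<open>\<eta>\<close> into the image grows when \<open>\<eta>\<close> is multiplied by
  suitable linear forms, until it spans.\<close>

lemma surjectivity:
  assumes "CARD('m) \<ge> 3"
    and local_or_span: "\<And>J. J \<subseteq> I \<Longrightarrow>
      (\<exists>L' :: 'k ^ 'n::{finite,linorder} ^ 'm::{finite,linorder}.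
          L' ** M = mat 1 \<and> (\<forall>h\<in>J. a h = transpose L' *v b h))
      \<or> vec.span (b ` J) = UNIV"
  shows "pull_vec M ` U = V"
proof
  show "pull_vec M ` U \<subseteq> V" using pull_vec_in_V by blast
  define F where "F \<eta> = {h \<in> I. to_fract (linear_form (b h)) *s \<eta> \<in> pull_vec M ` U}" for \<eta>
  have "\<eta> \<in> pull_vec M ` U" if "\<eta> \<in> V" for \<eta>
    using that
  proof (induction "card (I - F \<eta>)" arbitrary: \<eta> rule: less_induct)
    case less
    have F: "F \<eta> \<subseteq> I" by (auto simp: F_def)
    from local_or_span[OF F] show ?case
    proof
      assume "vec.span (b ` F \<eta>) = UNIV"
      then show ?thesis by (rule span_surjectivity[OF _ assms(1)]) (simp add: F_def)
    next
      assume "\<exists>L' :: 'k ^ 'n::{finite,linorder} ^ 'm::{finite,linorder}.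
        L' ** M = mat 1 \<and> (\<forall>h\<in>F \<eta>. a h = transpose L' *v b h)"
      then obtain L' :: "(('k, 'n) vec, 'm) vec" where
        L': "L' ** M = mat 1" "\<And>h. h \<in> F \<eta> \<Longrightarrow> a h = transpose L' *v b h" by blast
      \<comment> \<open>The projection is adapted to the forms in \<open>F \<eta>\<close>, so the
        product of all the others multiplies \<open>\<eta>\<close> into the image.\<close>
      have top: "to_fract (\<Prod>h\<in>I - F \<eta>. linear_form (b h)) *s \<eta> \<in> pull_vec M ` U"
        using fin by (intro local_surjectivity[OF L' _ less.prems]) (auto intro: dvd_prodI)
      have "\<eta> \<in> pull_vec M ` U"
        if "finite J" "J \<subseteq> I - F \<eta>" "to_fract (\<Prod>h\<in>J. linear_form (b h)) *s \<eta> \<in> pull_vec M ` U" for J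
        using that
      proof (induction J)
        case empty
        then show ?case by simp
      next
        case (insert k J)
        let ?\<eta> = "to_fract (\<Prod>h\<in>J. linear_form (b h)) *s \<eta>"
        have "to_fract (linear_form (b k)) *s ?\<eta> \<in> pull_vec M ` U"
          using insert.prems insert.hyps by simp
        then have "k \<in> F ?\<eta>" using insert.prems by (simp add: F_def)
        moreover have "F \<eta> \<subseteq> F ?\<eta>"
        proof
          fix h assume "h \<in> F \<eta>"
          then have "h \<in> I" "to_fract (\<Prod>h\<in>J. linear_form (b h)) *s
              (to_fract (linear_form (b h)) *s \<eta>) \<in> pull_vec M ` U"
            by (simp_all only: F_def mem_Collect_eq image_U_scale simp_thms)
          then show "h \<in> F ?\<eta>"
            by (simp only: F_def mem_Collect_eq vec.scale_scale mult.commute simp_thms)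
        qed
        ultimately have "I - F ?\<eta> \<subset> I - F \<eta>" using insert.prems by blast
        then have "card (I - F ?\<eta>) < card (I - F \<eta>)" using fin by (simp add: psubset_card_mono)
        then have "?\<eta> \<in> pull_vec M ` U" using less.hyps V_closed(2)[OF less.prems] by blast
        then show ?case using insert by blast
      qed
      from this[OF _ subset_refl top] show ?thesis using fin by simp
    qed
  qed
  then show "V \<subseteq> pull_vec M ` U" by blast
qed

section \<open>Restriction of rational coefficients\<close>

lemma pullback_poly_surj: "\<exists>p. pullback_poly M p = r"
proof
  show "pullback_poly M (pullback_poly L r) = r"
    by (simp only: pullback_poly_compose left_inverse pullback_poly_mat_1)
qed

lemma pullback_prod_neq_0: "pullback_poly M (\<Prod>h\<in>I. linear_form (a h)) \<noteq> 0"
  unfolding pullback_prod using nonparallel_b fin by (auto simp: nonparallel_def)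

text \<open>Equality of two fractions, cross-multiplied, is a polynomial identity and survives
  substitution. So every denominator with nonzero pullback gives the same value.\<close>

lemma pullback_rat_fun_eq:
  assumes "pullback_poly M q \<noteq> 0" "to_fract q * f = to_fract p"
  shows "pullback_rat_fun M f = to_fract (pullback_poly M p) / to_fract (pullback_poly M q)"
  unfolding pullback_rat_fun_def
proof (rule the_equality)
  have "q \<noteq> 0" using assms(1) by auto
  then have f: "f = to_fract p / to_fract q"
    using assms(2) by (metis nonzero_mult_div_cancel_left to_fract_eq_0_iff)
  then show "\<exists>p' q'. pullback_poly M q' \<noteq> 0 \<and> f = to_fract p' / to_fract q' \<and>
      to_fract (pullback_poly M p) / to_fract (pullback_poly M q)
        = to_fract (pullback_poly M p') / to_fract (pullback_poly M q')"
    using assms(1) by blast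
  fix g assume "\<exists>p' q'. pullback_poly M q' \<noteq> 0 \<and> f = to_fract p' / to_fract q' \<and>
      g = to_fract (pullback_poly M p') / to_fract (pullback_poly M q')"
  then obtain p' q' where g: "pullback_poly M q' \<noteq> 0" "f = to_fract p' / to_fract q'"
      "g = to_fract (pullback_poly M p') / to_fract (pullback_poly M q')" by blast
  then have "q' \<noteq> 0" by auto
  have "to_fract p / to_fract q = to_fract p' / to_fract q'" using f g(2) by (rule box_equals[OF refl])
  then have "to_fract (p * q') = to_fract (p' * q)"
    using \<open>q \<noteq> 0\<close> \<open>q' \<noteq> 0\<close> by (simp only: frac_eq_eq to_fract_eq_0_iff to_fract_mult not_False_eq_True)
  then have "pullback_poly M (p * q') = pullback_poly M (p' * q)" by (simp only: to_fract_eq_iff)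
  then have "to_fract (pullback_poly M p') * to_fract (pullback_poly M q)
      = to_fract (pullback_poly M p) * to_fract (pullback_poly M q')"
    by (simp only: pullback_poly_mult to_fract_mult[symmetric])
  then show "g = to_fract (pullback_poly M p) / to_fract (pullback_poly M q)"
    using assms(1) g(1) unfolding g(3)
    by (simp only: frac_eq_eq to_fract_eq_0_iff not_False_eq_True)
qed

text \<open>The other half of \<open>pullback_1_form\<close>: coefficients are moved to the section
  while all ambient differentials are kept.\<close>

definition restrict_coeffs ::
  "('k, 'n) rat_fun ^ 'n::{finite,linorder} \<Rightarrow> ('k, 'm) rat_fun ^ 'n::{finite,linorder}"
  where "restrict_coeffs \<omega> = map_vec (pullback_rat_fun M) \<omega>"

lemma pullback_1_form_eq: "pullback_1_form M \<omega> = pull_vec M (restrict_coeffs \<omega>)"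
  by (simp add: pullback_1_form_def pull_vec_def restrict_coeffs_def)

text \<open>All coefficients of \<open>\<omega>\<close> share the denominator \<open>Q\<close>,
  whose pullback is nonzero. Multiplied by \<open>Q\<close>, the pairing is a polynomial identity
  that can be pulled back and divided again.\<close>

lemma restrict_coeffs_pairing:
  assumes "\<omega> \<in> dual_forms (mat 1) I a" "\<theta> \<in> covector_derivations I a"
    and "scalar_product (map_vec to_fract \<theta>) \<omega> = to_fract s"
  shows "scalar_product (map_vec (\<lambda>p. to_fract (pullback_poly M p)) \<theta>) (restrict_coeffs \<omega>)
    = to_fract (pullback_poly M s)"
proof -
  define Q where "Q = (\<Prod>h\<in>I. linear_form (a h))"
  have Q0: "pullback_poly M Q \<noteq> 0" unfolding Q_def by (rule pullback_prod_neq_0)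
  have "\<forall>j. \<exists>p. to_fract Q * \<omega> $ j = to_fract p"
    using dual_forms_regular[OF assms(1) fin] unfolding pullback_poly_mat_1 Q_def by blast
  then obtain p where p: "\<And>j. to_fract Q * \<omega> $ j = to_fract (p j)" by metis
  have "to_fract (\<Sum>j\<in>UNIV. \<theta> $ j * p j) = (\<Sum>j\<in>UNIV. to_fract (\<theta> $ j) * (to_fract Q * \<omega> $ j))"
    by (simp only: to_fract_sum to_fract_mult p)
  also have "\<dots> = to_fract Q * scalar_product (map_vec to_fract \<theta>) \<omega>"
    unfolding scalar_product_def sum_distrib_left map_vec_nth
    by (intro sum.cong refl) (simp only: mult_ac)
  also have "\<dots> = to_fract (Q * s)" by (simp only: assms(3) to_fract_mult)
  finally have "pullback_poly M (\<Sum>j\<in>UNIV. \<theta> $ j * p j) = pullback_poly M (Q * s)"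
    by (simp only: to_fract_eq_iff)
  then have eq: "(\<Sum>j\<in>UNIV. pullback_poly M (\<theta> $ j) * pullback_poly M (p j)) = pullback_poly M Q * pullback_poly M s"
    by (simp only: pullback_poly_sum pullback_poly_mult)
  have "scalar_product (map_vec (\<lambda>p. to_fract (pullback_poly M p)) \<theta>) (restrict_coeffs \<omega>)
      = (\<Sum>j\<in>UNIV. to_fract (pullback_poly M (\<theta> $ j) * pullback_poly M (p j)) / to_fract (pullback_poly M Q))"
    unfolding scalar_product_def restrict_coeffs_def map_vec_nth pullback_rat_fun_eq[OF Q0 p]
    by (simp only: to_fract_mult times_divide_eq_right)
  also have "\<dots> = to_fract (\<Sum>j\<in>UNIV. pullback_poly M (\<theta> $ j) * pullback_poly M (p j)) / to_fract (pullback_poly M Q)"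
    by (simp only: sum_divide_distrib to_fract_sum)
  also have "\<dots> = to_fract (pullback_poly M s)"
    unfolding eq using Q0 by simp
  finally show ?thesis .
qed

lemma restrict_coeffs_in_U:
  assumes "\<omega> \<in> dual_forms (mat 1) I a"
  shows "restrict_coeffs \<omega> \<in> U"
  unfolding U_def dual_forms_def
proof safe
  fix \<theta> assume \<theta>: "\<theta> \<in> covector_derivations I a"
  obtain s where "scalar_product (map_vec to_fract \<theta>) \<omega> = to_fract s"
    using dual_formsD[OF assms \<theta>] unfolding pullback_poly_mat_1 by blast
  from restrict_coeffs_pairing[OF assms \<theta> this]
  show "scalar_product (map_vec (\<lambda>p. to_fract (pullback_poly M p)) \<theta>) (restrict_coeffs \<omega>)
    \<in> range to_fract" by (simp only: rangeI)
qed

lemma dual_forms_numerator: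
  assumes "\<omega> \<in> dual_forms (mat 1) I a"
  obtains p where "to_fract (\<Prod>h\<in>I. linear_form (a h)) * \<omega> $ j = to_fract p"
  using dual_forms_regular[OF assms fin, of j] unfolding pullback_poly_mat_1 by blast

text \<open>Since \<open>pullback_rat_fun\<close> is meaningful only for suitable denominators,
  additivity is proved on dual forms, where one denominator serves both summands.\<close>

lemma restrict_coeffs_add:
  assumes "\<omega> \<in> dual_forms (mat 1) I a" "\<omega>' \<in> dual_forms (mat 1) I a"
  shows "restrict_coeffs (\<omega> + \<omega>') = restrict_coeffs \<omega> + restrict_coeffs \<omega>'"
proof -
  have "restrict_coeffs (\<omega> + \<omega>') $ j = restrict_coeffs \<omega> $ j + restrict_coeffs \<omega>' $ j" for j
  proof -
    obtain p where p: "to_fract (\<Prod>h\<in>I. linear_form (a h)) * \<omega> $ j = to_fract p"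
      by (rule dual_forms_numerator[OF assms(1)])
    obtain p' where p': "to_fract (\<Prod>h\<in>I. linear_form (a h)) * \<omega>' $ j = to_fract p'"
      by (rule dual_forms_numerator[OF assms(2)])
    have "to_fract (\<Prod>h\<in>I. linear_form (a h)) * (\<omega> + \<omega>') $ j = to_fract (p + p')"
      by (simp only: vector_add_component distrib_left p p' to_fract_add)
    from pullback_rat_fun_eq[OF pullback_prod_neq_0 this] show ?thesis
      by (simp only: restrict_coeffs_def map_vec_nth pullback_rat_fun_eq[OF pullback_prod_neq_0 p]
          pullback_rat_fun_eq[OF pullback_prod_neq_0 p'] pullback_poly_add to_fract_add add_divide_distrib)
  qed
  then show ?thesis by (simp only: vec_eq_iff vector_add_component simp_thms)
qed

lemma restrict_coeffs_scale:
  assumes "\<omega> \<in> dual_forms (mat 1) I a"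
  shows "restrict_coeffs (to_fract c *s \<omega>) = to_fract (pullback_poly M c) *s restrict_coeffs \<omega>"
proof -
  have "restrict_coeffs (to_fract c *s \<omega>) $ j
      = to_fract (pullback_poly M c) * restrict_coeffs \<omega> $ j" for j
  proof -
    obtain p where p: "to_fract (\<Prod>h\<in>I. linear_form (a h)) * \<omega> $ j = to_fract p"
      by (rule dual_forms_numerator[OF assms(1)])
    have "to_fract (\<Prod>h\<in>I. linear_form (a h)) * (to_fract c *s \<omega>) $ j = to_fract (c * p)"
      by (simp only: vector_smult_component mult.left_commute[of _ "to_fract c"] p to_fract_mult)
    from pullback_rat_fun_eq[OF pullback_prod_neq_0 this] show ?thesis
      by (simp only: restrict_coeffs_def map_vec_nth pullback_rat_fun_eq[OF pullback_prod_neq_0 p]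
          pullback_poly_mult to_fract_mult times_divide_eq_right)
  qed
  then show ?thesis by (simp only: vec_eq_iff vector_smult_component simp_thms)
qed

lemma restrict_coeffs_sum:
  assumes "finite B" "B \<subseteq> dual_forms (mat 1) I a"
  shows "restrict_coeffs (\<Sum>x\<in>B. to_fract (c x) *s x)
    = (\<Sum>x\<in>B. to_fract (pullback_poly M (c x)) *s restrict_coeffs x)"
  using assms
proof (induction B)
  case empty
  have "restrict_coeffs (to_fract 0 *s 0) = to_fract (pullback_poly M 0) *s restrict_coeffs 0"
    by (rule restrict_coeffs_scale[OF dual_forms_zero])
  then show ?case by simp
next
  case (insert x B)
  then have x: "x \<in> dual_forms (mat 1) I a" by simp
  have "(\<Sum>x\<in>B. to_fract (c x) *s x) \<in> dual_forms (mat 1) I a"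
    using insert.prems by (intro dual_forms_sum dual_forms_scale) auto
  from restrict_coeffs_add[OF dual_forms_scale[OF x] this] insert show ?case
    by (simp add: restrict_coeffs_scale[OF x])
qed

text \<open>A form in \<open>U\<close> is determined by its pairings with the \<open>T i\<close>.
  These are polynomials on the section and lift to ambient polynomials \<open>s i\<close>. As the
  dual basis imposes no relations, any choice of lifts assembles to a logarithmic form.\<close>

lemma restrict_coeffs_surj:
  assumes free: "free_submodule (*s) (covector_derivations I a)" and "w \<in> U"
  shows "w \<in> restrict_coeffs ` dual_forms (mat 1) I a"
proof -
  define Q where "Q = (\<Prod>h\<in>I. linear_form (a h))"
  have Q0: "Q \<noteq> 0" and Q1: "pullback_poly M Q \<noteq> 0"
    using pullback_prod_neq_0 by (auto simp: Q_def)
  obtain T :: "'n \<Rightarrow> (('k, 'n) coord_ring, 'n) vec" and q where T: "\<And>i. T i \<in> covector_derivations I a"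
    "\<And>\<theta>. \<theta> \<in> covector_derivations I a \<Longrightarrow> \<exists>r. \<theta> = (\<Sum>i\<in>UNIV. r i *s T i)"
    and q: "\<And>j. axis j Q = (\<Sum>i\<in>UNIV. q j i *s T i)"
    "\<And>i k. (\<Sum>j\<in>UNIV. T k $ j * q j i) = (if k = i then Q else 0)"
    by (rule free_dual_basis[OF nonparallel free], fold Q_def) (rule that; assumption)
  have "\<exists>s. scalar_product (map_vec (\<lambda>p. to_fract (pullback_poly M p)) (T i)) w
      = to_fract (pullback_poly M s)" for i
  proof -
    obtain r where r: "scalar_product (map_vec (\<lambda>p. to_fract (pullback_poly M p)) (T i)) w = to_fract r"
      using dual_formsD[OF assms(2)[unfolded U_def] T(1)] by blast
    obtain s where "pullback_poly M s = r" using pullback_poly_surj by blast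
    with r show ?thesis by (intro exI[of _ s]) (simp only:)
  qed
  then obtain s where s: "\<And>i. scalar_product (map_vec (\<lambda>p. to_fract (pullback_poly M p)) (T i)) w
      = to_fract (pullback_poly M (s i))" by metis
  define \<omega> :: "(('k, 'n) rat_fun, 'n) vec" where
    "\<omega> = (\<chi> j. to_fract (\<Sum>i\<in>UNIV. q j i * s i) / to_fract Q)"
  have \<omega>Q: "to_fract Q * \<omega> $ j = to_fract (\<Sum>i\<in>UNIV. q j i * s i)" for j
    unfolding \<omega>_def vec_lambda_beta using Q0 by simp
  have "\<omega> \<in> dual_forms (mat 1) I a"
  proof (rule dual_formsI_generators[OF T(2)], unfold pullback_poly_mat_1)
    fix k
    have "(\<Sum>j\<in>UNIV. T k $ j * (\<Sum>i\<in>UNIV. q j i * s i)) = (\<Sum>i\<in>UNIV. (\<Sum>j\<in>UNIV. T k $ j * q j i) * s i)"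
      unfolding sum_distrib_left sum_distrib_right mult.assoc by (rule sum.swap)
    also have "\<dots> = (\<Sum>i\<in>UNIV. if k = i then Q * s k else 0)"
      unfolding q(2) by (intro sum.cong) auto
    also have "\<dots> = Q * s k" by simp
    finally have sum: "(\<Sum>j\<in>UNIV. T k $ j * (\<Sum>i\<in>UNIV. q j i * s i)) = Q * s k" .
    have "scalar_product (map_vec to_fract (T k)) \<omega>
        = to_fract (\<Sum>j\<in>UNIV. T k $ j * (\<Sum>i\<in>UNIV. q j i * s i)) / to_fract Q"
      unfolding scalar_product_def \<omega>_def vec_lambda_beta map_vec_nth
      by (simp only: to_fract_sum[of "\<lambda>j. T k $ j * _ j"] to_fract_mult sum_divide_distrib times_divide_eq_right)
    also have "\<dots> = to_fract (s k)" unfolding sum using Q0 by simp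
    finally show "scalar_product (map_vec to_fract (T k)) \<omega> \<in> range to_fract" by (simp only: rangeI)
  qed
  moreover have "restrict_coeffs \<omega> $ j = w $ j" for j
  proof -
    have "restrict_coeffs \<omega> $ j = to_fract (pullback_poly M (\<Sum>i\<in>UNIV. q j i * s i)) / to_fract (pullback_poly M Q)"
      unfolding restrict_coeffs_def map_vec_nth by (rule pullback_rat_fun_eq[OF Q1 \<omega>Q])
    also have "to_fract (pullback_poly M (\<Sum>i\<in>UNIV. q j i * s i)) = to_fract (pullback_poly M Q) * w $ j"
      unfolding dual_forms_expand[of j Q q T M w, OF q(1)] s
      by (simp only: pullback_poly_sum pullback_poly_mult to_fract_sum to_fract_mult)
    also have "to_fract (pullback_poly M Q) * w $ j / to_fract (pullback_poly M Q) = w $ j"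
      using Q1 by simp
    finally show ?thesis .
  qed
  then have "w = restrict_coeffs \<omega>" by (simp only: vec_eq_iff simp_thms)
  ultimately show ?thesis by blast
qed

lemma pullback_1_form_image:
  assumes "free_submodule (*s) (covector_derivations I a)"
  shows "pullback_1_form M ` dual_forms (mat 1) I a = pull_vec M ` U"
proof -
  have "restrict_coeffs ` dual_forms (mat 1) I a = U"
    using restrict_coeffs_in_U restrict_coeffs_surj[OF assms] by blast
  then show ?thesis unfolding pullback_1_form_eq image_image[symmetric] by simp
qed

text \<open>Restriction is semilinear over \<open>pullback_poly M\<close>, so the coefficients of an
  expansion are pulled back and generators go to generators.\<close>

lemma span_pullback_1_form:
  assumes B: "finite B" "module.span rat_scale B = dual_forms (mat 1) I a"
    and surj: "pullback_1_form M ` dual_forms (mat 1) I a = V"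
  shows "module.span rat_scale (pullback_1_form M ` B) = V"
proof -
  interpret n: module "rat_scale :: ('k, 'n) coord_ring \<Rightarrow> _" by (rule module_rat_scale)
  interpret m: module "rat_scale :: ('k, 'm) coord_ring \<Rightarrow> _" by (rule module_rat_scale)
  have BU: "B \<subseteq> dual_forms (mat 1) I a" using B(2) n.span_superset by blast
  have "m.subspace V"
    by (rule m.subspaceI) (simp_all only: rat_scale_def V_closed)
  then have "m.span (pullback_1_form M ` B) \<subseteq> V"
    using BU surj by (intro m.span_minimal) auto
  moreover have "v \<in> m.span (pullback_1_form M ` B)" if v: "v \<in> V" for v
  proof -
    obtain \<omega> where \<omega>: "\<omega> \<in> n.span B" "v = pullback_1_form M \<omega>" using v surj B(2) by blast
    from \<omega>(1) obtain r where r: "\<omega> = (\<Sum>x\<in>B. to_fract (r x) *s x)"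
      unfolding n.span_finite[OF B(1)] rat_scale_def by auto
    have "v = (\<Sum>x\<in>B. rat_scale (pullback_poly M (r x)) (pullback_1_form M x))"
      unfolding \<omega>(2) r pullback_1_form_eq restrict_coeffs_sum[OF B(1) BU] pull_vec_sum
        pull_vec_scale rat_scale_def ..
    then show ?thesis by (simp only:) (intro m.span_sum m.span_scale m.span_base imageI)
  qed
  ultimately show ?thesis by blast
qed

text \<open>Relations among the restricted generators have coefficients without constant term, so no
  generator becomes redundant.\<close>

lemma card_generators_V:
  assumes free: "free_submodule (*s) (covector_derivations I a)"
    and const: "\<And>\<theta> j. \<theta> \<in> covector_derivations I a \<Longrightarrow> Poly_Mapping.lookup (\<theta> $ j) 0 = 0"
    and surj: "pull_vec M ` U = V"
    and B: "finite B" "module.span rat_scale B = V"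
  shows "CARD('n) \<le> card B"
proof -
  interpret m: module "rat_scale :: ('k, 'm) coord_ring \<Rightarrow> _" by (rule module_rat_scale)
  define Q where "Q = (\<Prod>h\<in>I. linear_form (a h))"
  have Q1: "pullback_poly M Q \<noteq> 0"
    using pullback_prod_neq_0 by (auto simp: Q_def)
  obtain T :: "'n \<Rightarrow> (('k, 'n) coord_ring, 'n) vec" and q where T: "\<And>i. T i \<in> covector_derivations I a"
    "\<And>\<theta>. \<theta> \<in> covector_derivations I a \<Longrightarrow> \<exists>r. \<theta> = (\<Sum>i\<in>UNIV. r i *s T i)"
    and q: "\<And>j. axis j Q = (\<Sum>i\<in>UNIV. q j i *s T i)"
    "\<And>i k. (\<Sum>j\<in>UNIV. T k $ j * q j i) = (if k = i then Q else 0)"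
    by (rule free_dual_basis[OF nonparallel free], fold Q_def) (rule that; assumption)
  let ?p = "\<lambda>k. scalar_product (map_vec (\<lambda>p. to_fract (pullback_poly M p)) (T k))"
  have "\<forall>v\<in>B. \<exists>w\<in>U. pull_vec M w = v"
  proof
    fix v assume "v \<in> B"
    then have "v \<in> pull_vec M ` U" unfolding surj B(2)[symmetric] by (rule m.span_base)
    then show "\<exists>w\<in>U. pull_vec M w = v" by auto
  qed
  then obtain g where g: "\<And>v. v \<in> B \<Longrightarrow> g v \<in> U" "\<And>v. v \<in> B \<Longrightarrow> pull_vec M (g v) = v"
    by metis
  have "\<forall>v k. \<exists>y. v \<in> B \<longrightarrow> ?p k (g v) = to_fract y"
    using dual_formsD[OF g(1)[unfolded U_def] T(1)] by blast
  then obtain y where y: "\<And>v k. v \<in> B \<Longrightarrow> ?p k (g v) = to_fract (y v k)" by metis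
  \<comment> \<open>The coordinates of the lift \<open>g v\<close> in the dual basis, evaluated at
    the origin. It suffices that these vectors span the whole scalar space.\<close>
  define Y where "Y v = (\<chi> k. Poly_Mapping.lookup (y v k) 0)" for v
  have "axis i 1 \<in> vec.span (Y ` B)" for i
  proof -
    define W :: "(('k, 'm) rat_fun, 'n) vec" where
      "W = (\<chi> j. to_fract (pullback_poly M (q j i)) / to_fract (pullback_poly M Q))"
    have pW: "?p k W = to_fract (if k = i then 1 else 0)" for k
    proof -
      have "?p k W = to_fract (pullback_poly M (\<Sum>j\<in>UNIV. T k $ j * q j i)) / to_fract (pullback_poly M Q)"
        unfolding scalar_product_def W_def vec_lambda_beta map_vec_nth
        by (simp only: pullback_poly_sum pullback_poly_mult to_fract_sum to_fract_mult
            sum_divide_distrib times_divide_eq_right)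
      also have "\<dots> = to_fract (if k = i then 1 else 0)" unfolding q(2) using Q1 by simp
      finally show ?thesis .
    qed
    have WU: "W \<in> U" unfolding U_def
      by (rule dual_formsI_generators[OF T(2)]) (auto simp only: pW rangeI)
    then have "pull_vec M W \<in> m.span B" unfolding B(2) by (rule pull_vec_in_V)
    then obtain r where r: "pull_vec M W = (\<Sum>v\<in>B. rat_scale (r v) v)"
      unfolding m.span_finite[OF B(1)] by auto
    \<comment> \<open>\<open>W\<close> is the restricted dual basis element with index
      \<open>i\<close>. The combination of lifts has the same restriction to the section, so the
      difference is regular by \<open>kernel_regular\<close>.\<close>
    define D where "D = W - (\<Sum>v\<in>B. to_fract (r v) *s g v)"
    have "(\<Sum>v\<in>B. to_fract (r v) *s g v) \<in> U"
      unfolding U_def by (intro dual_forms_sum dual_forms_scale g(1)[unfolded U_def])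
    then have DU: "D \<in> U" unfolding D_def using WU U_closed by blast
    have "pull_vec M D = (\<Sum>v\<in>B. rat_scale (r v) v) - (\<Sum>v\<in>B. to_fract (r v) *s v)"
      unfolding D_def pull_vec_diff pull_vec_sum pull_vec_scale r using g(2) by simp
    also have "\<dots> = 0" by (simp only: rat_scale_def diff_self)
    finally have "\<exists>d. D $ l = to_fract d" for l using kernel_regular[OF DU] by blast
    then obtain d where d: "\<And>l. D $ l = to_fract (d l)" by metis
    have "axis i 1 $ k = (\<Sum>v\<in>B. Poly_Mapping.lookup (r v) 0 *s Y v) $ k" for k
    proof -
      have "to_fract (\<Sum>l\<in>UNIV. pullback_poly M (T k $ l) * d l) = ?p k D"
        by (simp only: scalar_product_def map_vec_nth d to_fract_sum to_fract_mult)
      also have "\<dots> = to_fract (if k = i then 1 else 0) - (\<Sum>v\<in>B. to_fract (r v) * to_fract (y v k))"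
        unfolding D_def scalar_product_diff_right scalar_product_sum_right scalar_product_scale_right pW
        using y by simp
      also have "\<dots> = to_fract ((if k = i then 1 else 0) - (\<Sum>v\<in>B. r v * y v k))"
        by (simp only: to_fract_diff to_fract_sum to_fract_mult)
      finally have eq: "(\<Sum>l\<in>UNIV. pullback_poly M (T k $ l) * d l)
          = (if k = i then 1 else 0) - (\<Sum>v\<in>B. r v * y v k)" by (simp only: to_fract_eq_iff)
      \<comment> \<open>Here \<open>D\<close> being regular and \<open>T k\<close> having no
        constant terms combine: the error vanishes at the origin, and the coordinates of
        \<open>W\<close> there come from \<open>B\<close> alone.\<close>
      have "Poly_Mapping.lookup (\<Sum>l\<in>UNIV. pullback_poly M (T k $ l) * d l) 0 = 0"
        by (simp add: lookup_sum lookup_mult_0 const[OF T(1)])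
      then have "Poly_Mapping.lookup (if k = i then 1 else 0 :: ('k, 'm) coord_ring) 0
          = (\<Sum>v\<in>B. Poly_Mapping.lookup (r v) 0 * Poly_Mapping.lookup (y v k) 0)"
        unfolding eq by (simp add: lookup_minus lookup_sum lookup_mult_0)
      then show ?thesis by (simp add: Y_def axis_def split: if_splits)
    qed
    then have "axis i 1 = (\<Sum>v\<in>B. Poly_Mapping.lookup (r v) 0 *s Y v)"
      by (simp only: vec_eq_iff simp_thms)
    then show ?thesis by (simp only:) (intro vec.span_sum vec.span_scale vec.span_base imageI)
  qed
  then have "cart_basis \<subseteq> vec.span (Y ` B)" by (auto simp: cart_basis_def)
  then have "UNIV \<subseteq> vec.span (Y ` B)"
    using vec.span_minimal[OF _ vec.subspace_span] span_cart_basis by metis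
  then have "vec.dim (UNIV :: ('k, 'n) vec set) \<le> card (Y ` B)"
    using B(1) by (intro vec.dim_le_card) auto
  then have "CARD('n) \<le> card (Y ` B)" by (simp only: vec_dim_card)
  also have "\<dots> \<le> card B" using B(1) by (rule card_image_le)
  finally show ?thesis .
qed

end

section \<open>Linear algebra of generic sections\<close>

text \<open>A linear map that kills \<open>K\<close> and fixes a vector outside \<open>K\<close> has
  a nonzero coordinate functional at that vector, and its coefficients form
  \<open>v\<close>.\<close>

lemma subspace_annihilator:
  fixes K :: "('k::field ^ 'n::finite) set"
  assumes "vec.subspace K" "K \<noteq> UNIV"
  obtains v where "v \<noteq> 0" "\<And>c. c \<in> K \<Longrightarrow> (\<Sum>i\<in>UNIV. v $ i * c $ i) = 0"
proof -
  obtain B where B: "B \<subseteq> K" "vec.independent B" "K \<subseteq> vec.span B"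
    using vec.maximal_independent_subset by blast
  have span: "vec.span B = K" using B assms(1) vec.span_minimal by blast
  obtain x where x: "x \<notin> K" using assms(2) by blast
  have ind: "vec.independent (insert x B)" using B(2) x span by (simp add: vec.independent_insert)
  obtain f :: "('k, 'n) vec \<Rightarrow> ('k, 'n) vec" where
    f: "Vector_Spaces.linear (*s) (*s) f" "\<forall>y\<in>insert x B. f y = (if y = x then x else 0)"
    using vec.linear_independent_extend[OF ind, of "\<lambda>y. if y = x then x else 0"] by blast
  interpret f: Vector_Spaces.linear "(*s)" "(*s)" f by (rule f(1))
  have "x \<notin> B" using x B(1) by blast
  have fK: "f c = 0" if "c \<in> K" for c
    using that unfolding span[symmetric]
  proof (rule f.eq_0_on_span[rotated])
    show "f y = 0" if "y \<in> B" for y using that f(2) \<open>x \<notin> B\<close> by auto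
  qed
  have "x \<noteq> 0" using x assms(1) vec.subspace_0 by blast
  then obtain i where i: "x $ i \<noteq> 0" by (auto simp: vec_eq_iff)
  define v where "v = (\<chi> j. f (axis j 1) $ i)"
  have v: "(\<Sum>j\<in>UNIV. v $ j * c $ j) = f c $ i" for c
    unfolding linear_componentwise[OF f(1), of c i] v_def by (simp add: mult.commute)
  show thesis
  proof
    have "f x = x" using f(2) by simp
    then have "(\<Sum>j\<in>UNIV. v $ j * x $ j) \<noteq> 0" using v[of x] i by simp
    then show "v \<noteq> 0" by auto
    show "(\<Sum>i\<in>UNIV. v $ i * c $ i) = 0" if "c \<in> K" for c
      using v[of c] fK[OF that] by simp
  qed
qed

lemma span_eq_UNIV_if_kernel_trivial:
  fixes C :: "('k::field ^ 'n::finite) set"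
  assumes "(\<Inter>c\<in>C. covector_kernel c) \<subseteq> {0}"
  shows "vec.span C = UNIV"
proof (rule ccontr)
  assume "vec.span C \<noteq> UNIV"
  then obtain v where v: "v \<noteq> 0" "\<And>c. c \<in> vec.span C \<Longrightarrow> (\<Sum>i\<in>UNIV. v $ i * c $ i) = 0"
    using subspace_annihilator[OF vec.subspace_span] by blast
  then have "v \<in> (\<Inter>c\<in>C. covector_kernel c)"
    by (auto simp: covector_kernel_def mult.commute vec.span_base)
  with assms v(1) show False by blast
qed

lemma subspace_covector_kernel: "vec.subspace (covector_kernel a)"
proof (rule vec.subspaceI)
  show "x + y \<in> covector_kernel a" if "x \<in> covector_kernel a" "y \<in> covector_kernel a" for x y
    using that by (simp add: covector_kernel_def distrib_left sum.distrib)
  show "c *s x \<in> covector_kernel a" if "x \<in> covector_kernel a" for c x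
  proof -
    have "(\<Sum>i\<in>UNIV. a $ i * (c *s x) $ i) = c * (\<Sum>i\<in>UNIV. a $ i * x $ i)"
      by (simp add: sum_distrib_left mult.left_commute)
    then show ?thesis using that by (simp add: covector_kernel_def)
  qed
qed (simp add: covector_kernel_def)

lemma subspace_eq_UNIV:
  fixes S :: "('k::field ^ 'n::finite) set"
  assumes "vec.subspace S" "vec.dim S = CARD('n)"
  shows "S = UNIV"
  by (rule vec.subspace_dim_equal[OF assms(1) vec.subspace_UNIV subset_UNIV])
    (simp only: vec_dim_card assms(2) order_refl)

lemma hyperplane_covector:
  fixes H :: "('k::field ^ 'n::finite) set"
  assumes "hyperplane H"
  shows "\<exists>a. a \<noteq> 0 \<and> covector_kernel a = H"
proof -
  have H: "vec.subspace H" "vec.dim H + 1 = CARD('n)" using assms by (auto simp: hyperplane_def)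
  then have "H \<noteq> UNIV" using vec_dim_card[where 'a='k and 'n='n] by auto
  then obtain v where v: "v \<noteq> 0" "\<And>c. c \<in> H \<Longrightarrow> (\<Sum>i\<in>UNIV. v $ i * c $ i) = 0"
    using subspace_annihilator[OF H(1)] by blast
  have sub: "H \<subseteq> covector_kernel v" using v(2) by (auto simp: covector_kernel_def)
  have "covector_kernel v \<noteq> UNIV" using v(1) by simp
  then have "vec.dim (covector_kernel v) \<noteq> CARD('n)"
    using subspace_eq_UNIV[OF subspace_covector_kernel] by blast
  then have "vec.dim (covector_kernel v) \<le> vec.dim H"
    using dim_subset_UNIV_cart_gen[of "covector_kernel v"] H(2) by linarith
  then have "H = covector_kernel v"
    using vec.subspace_dim_equal[OF H(1) subspace_covector_kernel sub] by blast
  with v(1) show ?thesis by blast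
qed

lemma covector_kernel_eq_imp_parallel:
  assumes "covector_kernel a = covector_kernel b" "a \<noteq> 0" "b \<noteq> 0"
  shows "\<exists>t. t \<noteq> 0 \<and> b = t *s a"
proof -
  obtain k where k: "a $ k \<noteq> 0" using assms(2) by (auto simp: vec_eq_iff)
  have sum: "(\<Sum>j\<in>UNIV. c $ j * (axis i s - axis k r) $ j) = c $ i * s - c $ k * r"
    for c :: "'a ^ 'b" and i s r
  proof -
    have "c $ j * (axis i s - axis k r) $ j
        = (if j = i then c $ i * s else 0) - (if j = k then c $ k * r else 0)" for j
      by (simp add: axis_def right_diff_distrib)
    then show ?thesis by (simp add: sum_subtractf)
  qed
  have "b $ i = b $ k / a $ k * a $ i" for i
  proof -
    \<comment> \<open>Evaluating \<open>b\<close> on this vector of the common kernel says that the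
      2 by 2 minor of \<open>a\<close> and \<open>b\<close> at \<open>i\<close>, \<open>k\<close>
      vanishes.\<close>
    have "axis i (a $ k) - axis k (a $ i) \<in> covector_kernel a"
      unfolding covector_kernel_def mem_Collect_eq sum by simp
    then have "axis i (a $ k) - axis k (a $ i) \<in> covector_kernel b" by (simp only: assms(1))
    then have "b $ i * a $ k - b $ k * a $ i = 0"
      unfolding covector_kernel_def mem_Collect_eq sum .
    then have "b $ i * a $ k = b $ k * a $ i" by (simp only: right_minus_eq)
    then have "b $ i = b $ k * a $ i / a $ k" using k by (simp only: nonzero_eq_divide_eq not_False_eq_True)
    then show ?thesis by (simp only: times_divide_eq_left)
  qed
  then obtain t where b: "b = t *s a"
    by (metis (no_types) vec_eq_iff vector_smult_component)
  then have "t \<noteq> 0" using assms(3) by auto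
  with b show ?thesis by blast
qed

lemma covector_kernel_transpose:
  "covector_kernel (transpose M *v a) = (*v) M -` covector_kernel a"
proof -
  have "(\<Sum>i\<in>UNIV. (transpose M *v a) $ i * t $ i) = (\<Sum>j\<in>UNIV. a $ j * (M *v t) $ j)" for t
  proof -
    have "(\<Sum>i\<in>UNIV. (transpose M *v a) $ i * t $ i) = (\<Sum>i\<in>UNIV. \<Sum>j\<in>UNIV. a $ j * (M $ j $ i * t $ i))"
      unfolding matrix_vector_mult_def transpose_def vec_lambda_beta sum_distrib_right
      by (intro sum.cong refl) (simp only: mult_ac)
    also have "\<dots> = (\<Sum>j\<in>UNIV. \<Sum>i\<in>UNIV. a $ j * (M $ j $ i * t $ i))" by (rule sum.swap)
    also have "\<dots> = (\<Sum>j\<in>UNIV. a $ j * (M *v t) $ j)"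
      unfolding matrix_vector_mult_def vec_lambda_beta sum_distrib_left ..
    finally show ?thesis .
  qed
  then show ?thesis unfolding covector_kernel_def by auto
qed

lemma dim_Int_hyperplane:
  fixes S :: "('k::field ^ 'n::finite) set"
  assumes "vec.subspace S" "hyperplane H"
  shows "vec.dim S \<le> vec.dim (S \<inter> H) + 1"
proof -
  have H: "vec.subspace H" "vec.dim H + 1 = CARD('n)" using assms(2) by (auto simp: hyperplane_def)
  have "vec.dim {x + y |x y. x \<in> S \<and> y \<in> H} \<le> CARD('n)" by (rule dim_subset_UNIV_cart_gen)
  then show ?thesis using vec.dim_sums_Int[OF assms(1) H(1)] H(2) by linarith
qed

lemma subspace_Inter_hyperplanes:
  "(\<And>H. H \<in> J \<Longrightarrow> hyperplane H) \<Longrightarrow> vec.subspace (\<Inter>J)"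
  by (rule vec.subspace_Inter) (simp add: hyperplane_def)

text \<open>Each further hyperplane raises the codimension by at most one, so no value is skipped.
  This reaches families too deep for the genericity condition through a subfamily of the largest
  admissible codimension.\<close>

lemma subset_of_given_codim:
  fixes J :: "('k::field ^ 'n::finite) set set"
  assumes "finite J" "\<And>H. H \<in> J \<Longrightarrow> hyperplane H" "k \<le> codim (\<Inter>J)"
  shows "\<exists>J'\<subseteq>J. codim (\<Inter>J') = k"
  using assms
proof (induction J)
  case empty
  have "codim (UNIV :: ('k, 'n) vec set) = 0" by (simp only: codim_def vec_dim_card diff_self_eq_0)
  with empty show ?case by simp
next
  case (insert H J)
  show ?case
  proof (cases "k \<le> codim (\<Inter>J)")
    case True
    then show ?thesis using insert by (metis insertI2 subset_insertI2)
  next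
    case False
    have "vec.dim (\<Inter>J) \<le> vec.dim (\<Inter>J \<inter> H) + 1"
      using insert.prems by (intro dim_Int_hyperplane subspace_Inter_hyperplanes) auto
    then have "codim (\<Inter>(insert H J)) \<le> codim (\<Inter>J) + 1"
      by (simp add: codim_def Int_commute)
    then have "codim (\<Inter>(insert H J)) = k" using False insert.prems by linarith
    then show ?thesis by blast
  qed
qed

text \<open>Injectivity on \<open>E\<close> says that no nonzero covector of \<open>E\<close>
  vanishes on the section. The covectors in \<open>E\<close> can then be recovered from their
  restrictions by a projection \<open>L'\<close> onto the section.\<close>

lemma section_left_inverse:
  fixes M :: "'k::field ^ 'm::finite ^ 'n::finite"
  assumes L: "L ** M = mat 1" and E: "vec.subspace E"
    and inj: "\<And>x. x \<in> E \<Longrightarrow> transpose M *v x = 0 \<Longrightarrow> x = 0"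
  obtains L' where "L' ** M = mat 1" "\<And>x. x \<in> E \<Longrightarrow> x = transpose L' *v (transpose M *v x)"
proof -
  have "inj_on ((*v) (transpose M)) E"
  proof (rule inj_onI)
    fix x y assume "x \<in> E" "y \<in> E" "transpose M *v x = transpose M *v y"
    then have "x - y = 0"
      by (intro inj) (simp_all only: vec.subspace_diff[OF E] matrix_vector_mult_diff_distrib diff_self)
    then show "x = y" by simp
  qed
  then obtain g where g: "Vector_Spaces.linear (*s) (*s) g" "\<forall>x\<in>E. g (transpose M *v x) = x"
    using vec.linear_exists_left_inverse_on[OF matrix_vector_mul_linear_gen E] by blast
  have gE: "matrix g *v (transpose M *v x) = x" if "x \<in> E" for x
    using g that by (simp only: matrix_works)
  have tL: "transpose M *v (transpose L *v y) = y" for y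
    by (simp only: matrix_vector_mul_assoc matrix_transpose_mul[symmetric] L transpose_mat
        matrix_vector_mul_lid)
  \<comment> \<open>\<open>g\<close> inverts restriction on \<open>E\<close> only, and
    \<open>transpose L\<close> is a right inverse of restriction that ignores \<open>E\<close>. The
    last term cancels what \<open>g\<close> contributes after restriction, so \<open>G\<close> is a
    right inverse everywhere. On restrictions of elements of \<open>E\<close> the two terms with
    \<open>L\<close> cancel.\<close>
  define G where "G = transpose L + matrix g - transpose L ** (transpose M ** matrix g)"
  have G: "G *v y = transpose L *v y + matrix g *v y
      - transpose L *v (transpose M *v (matrix g *v y))" for y
    by (simp only: G_def matrix_vector_mult_diff_rdistrib matrix_vector_mult_add_rdistrib
        matrix_vector_mul_assoc)
  show thesis
  proof (rule that[of "transpose G"])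
    have "transpose M *v (G *v y) = y" for y
      by (simp only: G matrix_vector_mult_diff_distrib matrix_vector_right_distrib tL add_diff_cancel)
    then have "transpose M ** G = mat 1"
      by (simp only: matrix_eq matrix_vector_mul_assoc[symmetric] matrix_vector_mul_lid simp_thms)
    then have "transpose (transpose M ** G) = transpose (mat 1)" by (simp only:)
    then show "transpose G ** M = mat 1"
      by (simp only: matrix_transpose_mul transpose_transpose transpose_mat)
    fix x assume "x \<in> E"
    then show "x = transpose (transpose G) *v (transpose M *v x)"
      by (simp only: transpose_transpose G gE add_diff_cancel_left')
  qed
qed

text \<open>Bridges the restricted covectors, indexed by ambient hyperplanes, and the chosen
  covectors of the hyperplanes of the section. They agree up to nonzero scalars, which are
  units.\<close>

lemma covector_derivations_reindex:
  fixes a :: "'h \<Rightarrow> 'k::field ^ 'n::finite"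
  assumes "\<And>h. h \<in> I \<Longrightarrow> \<exists>t. t \<noteq> 0 \<and> a h = t *s a' (f h)"
  shows "covector_derivations I a = covector_derivations (f ` I) a'"
proof -
  have "linear_form (a h) dvd scalar_product \<theta> (map_vec coord_const (a h))
      \<longleftrightarrow> linear_form (a' (f h)) dvd scalar_product \<theta> (map_vec coord_const (a' (f h)))"
    if h: "h \<in> I" for h and \<theta> :: "(('k, 'n) coord_ring, 'n) vec"
  proof -
    obtain t where t: "t \<noteq> 0" "a h = t *s a' (f h)" using assms[OF h] by blast
    have "coord_const t * coord_const (1 / t) = (1 :: ('k, 'n) coord_ring)"
      using t(1) by (simp flip: coord_const_mult)
    then have unit: "(coord_const t :: ('k, 'n) coord_ring) dvd 1" by (metis dvd_triv_left)
    have "scalar_product \<theta> (map_vec coord_const (a h))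
        = coord_const t * scalar_product \<theta> (map_vec coord_const (a' (f h)))"
      unfolding t(2) scalar_product_def map_vec_nth vector_smult_component coord_const_mult sum_distrib_left
      by (intro sum.cong refl) (simp only: mult_ac)
    moreover have "linear_form (a h) = coord_const t * linear_form (a' (f h))"
      unfolding t(2) by (rule linear_form_smult)
    moreover have "(coord_const t :: ('k, 'n) coord_ring) * x dvd coord_const t * y \<longleftrightarrow> x dvd y" for x y
    proof
      assume "coord_const t * x dvd coord_const t * y"
      then have "coord_const (1 / t) * (coord_const t * x) dvd coord_const (1 / t) * (coord_const t * y)"
        by (rule mult_dvd_mono[OF dvd_refl])
      then show "x dvd y" using t(1) by (simp add: mult.assoc[symmetric] coord_const_mult[symmetric])
    qed (rule mult_dvd_mono[OF dvd_refl])
    ultimately show ?thesis by (simp only:)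
  qed
  then show ?thesis by (simp add: covector_derivations_def)
qed

text \<open>The constant terms form a vector lying in every hyperplane: each value on a defining
  form is a multiple of that form and so vanishes at the origin.\<close>

lemma essential_derivations_const:
  fixes A :: "('k::field ^ 'n::finite) set set"
  assumes A: "covector_arrangement A" "\<Inter>A = {0}" and "\<theta> \<in> covector_derivations A defining_covector"
  shows "Poly_Mapping.lookup (\<theta> $ j) 0 = 0"
proof -
  define v where "v = (\<chi> i. Poly_Mapping.lookup (\<theta> $ i) 0)"
  have "v \<in> H" if H: "H \<in> A" for H
  proof -
    obtain p where "scalar_product \<theta> (map_vec coord_const (defining_covector H)) = defining_form H * p"
      using assms(3) H by (auto simp: covector_derivations_def elim!: dvdE)
    then have "Poly_Mapping.lookup (scalar_product \<theta> (map_vec coord_const (defining_covector H))) 0 = 0"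
      by (simp add: lookup_mult_0)
    then have "(\<Sum>i\<in>UNIV. defining_covector H $ i * v $ i) = 0"
      by (simp add: scalar_product_def lookup_sum lookup_mult_0 v_def mult.commute)
    then have "v \<in> covector_kernel (defining_covector H)" by (simp add: covector_kernel_def)
    then show ?thesis using defining_covector(1)[OF A(1) H] by simp
  qed
  then have "v = 0" using A(2) by blast
  then have "v $ j = 0" by simp
  then show ?thesis by (simp add: v_def)
qed

section \<open>Application to a generic section\<close>

theorem theorem3p1:
  fixes A :: "('k::field ^ 'n::{finite,linorder}) set set"
    and X :: "('k ^ 'n::{finite,linorder}) set"
    and M :: "'k ^ 'm::{finite,linorder} ^ 'n::{finite,linorder}"
  assumes "CARD('n) \<ge> 4"
    and "arrangement A" and "essential A" and "free_arrangement A"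
    and "vec.subspace X" and "generic_wrt A X" and "vec.dim X > 2"
    and "linear_coordinates M X"
  shows "pullback_1_form M ` log_1_forms A
           = log_1_forms (in_coordinates M (restrict_arrangement A X))
       \<and> min_generators rat_scale (log_1_forms A)
           = min_generators rat_scale (log_1_forms (in_coordinates M (restrict_arrangement A X)))
       \<and> \<not> free_arrangement (in_coordinates M (restrict_arrangement A X))"
proof -
  have hyp: "hyperplane H" if "H \<in> A" for H using assms(2) that by (simp add: arrangement_def)
  have fin: "finite A" using assms(2) by (simp add: arrangement_def)
  have cov: "covector_arrangement A"
    using fin hyp hyperplane_covector by (auto simp: covector_arrangement_def)
  have M: "inj ((*v) M)" "range ((*v) M) = X" using assms(8) by (auto simp: linear_coordinates_def)
  obtain L where L: "L ** M = mat 1" using M(1) matrix_left_invertible_injective by blast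

  have dimX: "vec.dim X = CARD('m)"
  proof -
    have "vec.dim (range ((*v) M)) = vec.dim (UNIV :: ('k, 'm) vec set)"
      using M(1) by (intro vec.dim_image_eq matrix_vector_mul_linear_gen) (simp add: inj_on_subset)
    then show ?thesis by (simp only: M(2) vec_dim_card)
  qed
  have dim_le: "vec.dim S \<le> CARD('n)" for S :: "('k, 'n) vec set" by (rule dim_subset_UNIV_cart_gen)
  \<comment> \<open>The truncated subtraction in \<open>codim\<close> is exact here, so the bound in
    \<open>generic_wrt\<close> is the dimension of \<open>X\<close>.\<close>
  have "CARD('n) - codim X = vec.dim X" using dim_le[of X] by (simp add: codim_def)
  then have gen: "X \<notin> intersection_lattice A"
    "\<And>Y. Y \<in> intersection_lattice A \<Longrightarrow> codim Y \<le> vec.dim X \<Longrightarrow> codim (X \<inter> Y) = codim X + codim Y"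
    using assms(6) unfolding generic_wrt_def by simp_all
  have lattice: "\<Inter>J \<in> intersection_lattice A" if "J \<subseteq> A" for J
    using that unfolding intersection_lattice_def by blast
  \<comment> \<open>The whole space is the empty intersection, so \<open>X\<close> is a proper
    subspace. The resulting strict inequality of dimensions is what excludes freeness in the
    end.\<close>
  have "UNIV \<in> intersection_lattice A" using lattice[of "{}"] by simp
  then have "X \<noteq> UNIV" using gen(1) by blast
  then have "vec.dim X \<noteq> CARD('n)"
    using subspace_eq_UNIV[OF assms(5)] by blast
  then have mn: "CARD('m) < CARD('n)" using dim_le[of X] dimX by linarith

  define a where "a = (defining_covector :: ('k, 'n) vec set \<Rightarrow> _)"
  have a: "covector_kernel (a H) = H" if "H \<in> A" for H
    unfolding a_def using defining_covector(1)[OF cov that] .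
  define b where "b H = transpose M *v a H" for H
  have b: "covector_kernel (b H) = (*v) M -` H" if "H \<in> A" for H
    unfolding b_def covector_kernel_transpose a[OF that] ..
  have codim_H: "codim H = 1" if "H \<in> A" for H
    using hyp[OF that] unfolding hyperplane_def codim_def by linarith
  have codim_XH: "codim (X \<inter> H) = codim X + 1" if "H \<in> A" for H
    using gen(2)[of H] lattice[of "{H}"] that codim_H[OF that] assms(7) by simp
  have X_Int: "X \<inter> H = (*v) M ` ((*v) M -` H)" for H using M(2) by blast
  have b0: "b H \<noteq> 0" if H: "H \<in> A" for H
  proof
    assume "b H = 0"
    then have "covector_kernel (b H) = UNIV" by simp
    then have "(*v) M -` H = UNIV" by (simp only: b[OF H])
    then have "X \<inter> H = X" by (simp only: X_Int[of H] M(2))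
    then show False using codim_XH[OF H] by simp
  qed
  \<comment> \<open>The intersection of two hyperplanes has codimension at most two, hence is
    covered by genericity. If both have the same trace on \<open>X\<close>, comparing codimensions
    forces their intersection to have codimension one.\<close>
  have inj_b: "H = H'" if H: "H \<in> A" "H' \<in> A" "covector_kernel (b H) = covector_kernel (b H')" for H H'
  proof -
    have sub: "vec.subspace H" "vec.subspace H'" using hyp H by (auto simp: hyperplane_def)
    have "X \<inter> H = X \<inter> H'"
      unfolding X_Int b[OF H(1), symmetric] b[OF H(2), symmetric] H(3) ..
    then have eq: "X \<inter> \<Inter>{H, H'} = X \<inter> H" by auto
    have "vec.dim H \<le> vec.dim (H \<inter> H') + 1" by (rule dim_Int_hyperplane[OF sub(1) hyp[OF H(2)]])
    then have "codim (\<Inter>{H, H'}) \<le> vec.dim X"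
      using codim_H[OF H(1)] assms(7) by (simp add: codim_def)
    from gen(2)[OF lattice this] have "codim (\<Inter>{H, H'}) = 1"
      using H eq codim_XH[OF H(1)] by simp
    then have "vec.dim (H \<inter> H') + 1 = CARD('n)" using assms(1) by (simp add: codim_def)
    then have "vec.dim H \<le> vec.dim (H \<inter> H')" "vec.dim H' \<le> vec.dim (H \<inter> H')"
      using hyp[OF H(1)] hyp[OF H(2)] by (auto simp: hyperplane_def)
    then have "H \<inter> H' = H" "H \<inter> H' = H'"
      using vec.subspace_dim_equal[OF vec.subspace_inter[OF sub]] sub by blast+
    then show ?thesis by blast
  qed
  have np: "nonparallel A a" unfolding a_def by (rule nonparallel_defining_covector[OF cov])
  have npb: "nonparallel A (\<lambda>H. transpose M *v a H)"
    unfolding b_def[symmetric] nonparallel_def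
  proof (intro conjI ballI impI allI)
    fix H H' t assume H: "H \<in> A" "H' \<in> A" "H \<noteq> H'"
    show "b H \<noteq> t *s b H'"
    proof
      assume eq: "b H = t *s b H'"
      then have "t \<noteq> 0" using b0[OF H(1)] by auto
      then have "covector_kernel (b H) = covector_kernel (b H')"
        unfolding eq by (rule covector_kernel_smult)
      then show False using inj_b H by blast
    qed
  qed (use fin b0 in auto)

  interpret s: arrangement_section A a M L
    using np npb L by (rule arrangement_section.intro)
  have sb: "s.b = b" by (simp add: fun_eq_iff s.b_def b_def)

  have dichotomy: "(\<exists>L' :: (('k, 'n) vec, 'm) vec. L' ** M = mat 1 \<and> (\<forall>h\<in>J. a h = transpose L' *v s.b h))
      \<or> vec.span (s.b ` J) = UNIV" if J: "J \<subseteq> A" for J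
  proof (cases "codim (\<Inter>J) \<le> vec.dim X")
    case True
    have subJ: "vec.subspace (\<Inter>J)" using J hyp by (intro subspace_Inter_hyperplanes) auto
    let ?S = "{x + y |x y. x \<in> X \<and> y \<in> \<Inter>J}"
    have "vec.dim ?S + vec.dim (X \<inter> \<Inter>J) = vec.dim X + vec.dim (\<Inter>J)"
      by (rule vec.dim_sums_Int[OF assms(5) subJ])
    moreover have "codim (X \<inter> \<Inter>J) = codim X + codim (\<Inter>J)" by (rule gen(2)[OF lattice[OF J] True])
    ultimately have "vec.dim ?S = CARD('n)"
      using True dim_le[of X] dim_le[of "\<Inter>J"] dim_le[of "X \<inter> \<Inter>J"] dim_le[of ?S]
      unfolding codim_def by linarith
    then have S: "vec.span ?S = UNIV"
      by (intro subspace_eq_UNIV vec.subspace_span) (simp only: vec.dim_span)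
    have kernel: "x = 0" if x: "x \<in> vec.span (a ` J)" "transpose M *v x = 0" for x
    proof -
      have "X \<subseteq> covector_kernel x"
      proof -
        have "(*v) M -` covector_kernel x = UNIV"
          unfolding covector_kernel_transpose[symmetric] x(2) by simp
        then show ?thesis using M(2) by blast
      qed
      moreover have "\<Inter>J \<subseteq> covector_kernel x"
      proof
        fix y assume y: "y \<in> \<Inter>J"
        have "a ` J \<subseteq> covector_kernel y"
        proof
          fix c assume "c \<in> a ` J"
          then obtain h where "h \<in> J" "c = a h" by blast
          then have "y \<in> covector_kernel c" using a J y by blast
          then show "c \<in> covector_kernel y" by (simp add: covector_kernel_def mult.commute)
        qed
        then have "x \<in> covector_kernel y"
          using x(1) vec.span_minimal[OF _ subspace_covector_kernel] by blast
        then show "y \<in> covector_kernel x" by (simp add: covector_kernel_def mult.commute)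
      qed
      ultimately have "?S \<subseteq> covector_kernel x"
        using vec.subspace_add[OF subspace_covector_kernel] by blast
      then have "covector_kernel x = UNIV"
        using S vec.span_minimal[OF _ subspace_covector_kernel] by blast
      then show "x = 0" by simp
    qed
    obtain L' :: "(('k, 'n) vec, 'm) vec" where L': "L' ** M = mat 1"
      "\<And>x. x \<in> vec.span (a ` J) \<Longrightarrow> x = transpose L' *v (transpose M *v x)"
      by (rule section_left_inverse[OF L vec.subspace_span[of "a ` J"]])
        (rule kernel that; assumption)+
    have "a h = transpose L' *v s.b h" if "h \<in> J" for h
      unfolding sb b_def by (rule L'(2)[OF vec.span_base[OF imageI[OF that]]])
    with L'(1) show ?thesis by blast
  next
    case False
    \<comment> \<open>Genericity does not apply to the flat of \<open>J\<close> itself. A subfamily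
      of codimension exactly \<open>vec.dim X\<close> already meets \<open>X\<close> only in the
      origin, so the restricted covectors have trivial common kernel.\<close>
    then obtain J' where J': "J' \<subseteq> J" "codim (\<Inter>J') = vec.dim X"
      using subset_of_given_codim[of J "vec.dim X"] J hyp fin finite_subset by (metis nat_le_linear subsetD)
    have "codim (X \<inter> \<Inter>J') = codim X + vec.dim X"
      using gen(2)[OF lattice[of J']] J' J by simp
    then have "vec.dim (X \<inter> \<Inter>J') = 0"
      using dim_le[of X] dim_le[of "X \<inter> \<Inter>J'"] assms(1) unfolding codim_def by linarith
    then have X0: "X \<inter> \<Inter>J' \<subseteq> {0}" by (simp add: vec.dim_eq_0)
    have "(\<Inter>c\<in>b ` J. covector_kernel c) \<subseteq> {0}"
    proof
      fix t assume t: "t \<in> (\<Inter>c\<in>b ` J. covector_kernel c)"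
      have "M *v t \<in> H" if "H \<in> J'" for H
        using t that J' J b by blast
      then have "M *v t \<in> X \<inter> \<Inter>J'" using M(2) by blast
      then have "M *v t = M *v 0" using X0 by auto
      from injD[OF M(1) this] show "t \<in> {0}" by simp
    qed
    then show ?thesis unfolding sb using span_eq_UNIV_if_kernel_trivial by blast
  qed

  define B where "B = in_coordinates M (restrict_arrangement A X)"
  have B: "B = (\<lambda>H. (*v) M -` H) ` A"
  proof -
    have "(*v) M -` (H \<inter> X) = (*v) M -` H" for H using M(2) by blast
    then show ?thesis
      unfolding B_def in_coordinates_def restrict_arrangement_def Setcompr_eq_image image_image by simp
  qed
  have covB: "covector_arrangement B"
    unfolding covector_arrangement_def B using fin b b0 by blast
  have derB: "covector_derivations B defining_covector = covector_derivations A s.b"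
    unfolding B sb
  proof (rule covector_derivations_reindex[symmetric])
    fix H assume H: "H \<in> A"
    then have "(*v) M -` H \<in> B" by (simp add: B)
    note defining_covector[OF covB this]
    then show "\<exists>t. t \<noteq> 0 \<and> b H = t *s defining_covector ((*v) M -` H)"
      using b[OF H] b0[OF H] by (intro covector_kernel_eq_imp_parallel) simp_all
  qed
  have logB: "log_1_forms B = s.V"
    unfolding log_1_forms_eq[OF covB] s.V_def dual_forms_def derB ..
  have logA: "log_1_forms A = dual_forms (mat 1) A a"
    unfolding a_def by (rule log_1_forms_eq[OF cov])
  have free: "free_submodule (*s) (covector_derivations A a)"
    using assms(4) by (simp add: free_arrangement_def log_derivations_eq a_def)

  have surjU: "pull_vec M ` s.U = s.V"
    using assms(7) dimX by (intro s.surjectivity dichotomy) simp_all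
  then have surj: "pullback_1_form M ` dual_forms (mat 1) A a = s.V"
    using s.pullback_1_form_image[OF free] by simp
  have const: "Poly_Mapping.lookup (\<theta> $ j) 0 = 0" if "\<theta> \<in> covector_derivations A a" for \<theta> j
    using essential_derivations_const[OF cov] assms(3) that by (simp add: essential_def a_def)
  \<comment> \<open>The next three bounds form a cycle: \<open>CARD('n)\<close> is at most the
    number for the section, which is at most the number for the ambient arrangement, which is at
    most \<open>CARD('n)\<close>.\<close>
  have lower: "enat CARD('n) \<le> min_generators rat_scale s.V"
    using s.card_generators_V[OF free const surjU] by (intro min_generators_ge) simp
  have mono: "min_generators rat_scale s.V \<le> min_generators rat_scale (dual_forms (mat 1) A a)"
  proof (rule min_generators_ge)
    fix G :: "(('k, 'n) rat_fun, 'n) vec set"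
    assume G: "finite G" "module.span rat_scale G = dual_forms (mat 1) A a"
    have "min_generators rat_scale s.V \<le> enat (card (pullback_1_form M ` G))"
      using G(1) s.span_pullback_1_form[OF G surj] by (intro min_generators_le) simp_all
    also have "\<dots> \<le> enat (card G)" using card_image_le[OF G(1)] by simp
    finally show "min_generators rat_scale s.V \<le> enat (card G)" .
  qed
  have upper: "min_generators rat_scale (dual_forms (mat 1) A a) \<le> enat CARD('n)"
  proof -
    obtain G where G: "finite G" "card G \<le> CARD('n)" "module.span rat_scale G = dual_forms (mat 1) A a"
      by (rule free_dual_forms_span[OF np free])
    have "min_generators rat_scale (dual_forms (mat 1) A a) \<le> enat (card G)"
      by (rule min_generators_le[OF G(1,3)])
    with G(2) show ?thesis by (metis enat_ord_simps(1) order_trans)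
  qed
  have "\<not> free_arrangement B"
  proof
    assume "free_arrangement B"
    then have freeB: "free_submodule (*s) (covector_derivations A s.b)"
      by (simp only: free_arrangement_def log_derivations_eq derB)
    obtain G where G: "finite G" "card G \<le> CARD('m)" "module.span rat_scale G = dual_forms (mat 1) A s.b"
      by (rule free_dual_forms_span[OF s.nonparallel_b freeB])
    have "CARD('n) \<le> card G"
      using s.card_generators_V[OF free const surjU G(1)] G(3) by (simp add: s.V_def)
    with G(2) mn show False by linarith
  qed
  moreover have "min_generators rat_scale (log_1_forms A) = min_generators rat_scale (log_1_forms B)"
    unfolding logA logB by (rule order_antisym[OF order_trans[OF upper lower] mono])
  moreover have "pullback_1_form M ` log_1_forms A = log_1_forms B"
    unfolding logA logB by (rule surj)
  ultimately show ?thesis unfolding B_def by blast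
qed

end
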